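(* Let $p$ be a prime, let $k$ be a positive integer, and let $X$ be a compact Hausdorff second-countable topological space acted upon continuously by $\mathbb{F}_p^\omega$. The following statements are equivalent: (1) The $\mathbb{F}_p^\omega$-system $X$ is a transitive topological Abramov system of order at most $k$. (2) There exists a morphism $f\in\hom(\mathcal{D}_1(\mathbb{F}_p^\omega),\mathcal{H}_{p,k})$ such that $X$ is conjugate (i.e. isomorphic as a topological dynamical system) to $(\overline{\mathrm{orb}(f)},\mathbb{F}_p^\omega)$.
   Context: $\mathbb{F}_p^\omega:=\bigoplus_{n=1}^\infty\mathbb{F}_p$ is viewed as a countable discrete abelian group. $\mathbb{N}$ is the set of positive integers. Topological notions: an $\mathbb{F}_p^\omega$-system $Y$ is transitive if some orbit is dense. For $\phi\in C(Y,\mathbb{C})$ let $\Delta_z\phi(y):=\phi(z\cdot y)\overline{\phi(y)}$. A continuous phase polynomial of degree at most $k$ is a $\phi\in C(Y,\mathbb{C})$ with $\Delta_{z_1}\cdots\Delta_{z_{k+1}}\phi(y)=1$ for all $y\in Y$, $z_1,\dots,z_{k+1}\in\mathbb{F}_p^\omega$. The system is topological Abramov of order at most $k$ if the algebra generated by (equivalently, the linear span of) the continuous phase polynomials of degree at most $k$ is dense in $C(Y,\mathbb{C})$ in the uniform norm. Two systems are conjugate if there is an equivariant homeomorphism between them. Group nilspaces: for an abelian group $G$ with a filtration $G_\bullet$, i.e. subgroups $G=G_{(0)}=G_{(1)}\ge G_{(2)}\ge\cdots$, the associated group nilspace is $G$ equipped, for each $n\ge0$, with the set of $n$-cubes $C^n(G)$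 consisting of the maps $c:\{0,1\}^n\to G$ of the form $c(v)=\sum_{S\subset\{1,\dots,n\}}g_S\prod_{i\in S}v_i$ with $g_S\in G_{(|S|)}$. For an abelian group $Z$, $\mathcal{D}_1(Z)$ is the group nilspace with $G_{(0)}=G_{(1)}=Z$ and $G_{(i)}=\{0\}$ for $i\ge2$, so its $n$-cubes are the maps $v\mapsto x+v_1h_1+\cdots+v_nh_n$. A morphism is a map $f$ such that $f\circ c$ is an $n$-cube for every $n$-cube $c$ of the domain, for every $n\ge 0$. The nilspace $\mathcal{H}_{p,k}$: for $1\le\ell\le k$ let $\mathcal{U}^{(p)}_{k,\ell}$ be the group nilspace of the cyclic group $G$ of order $p^{\lfloor\frac{k-\ell}{p-1}\rfloor+1}$ with filtration $G_{(i)}=G$ for $0\le i\le\ell$ and $G_{(i)}=p^{\lfloor\frac{i-\ell-1}{p-1}\rfloor+1}G$ for $i>\ell$. Then $\mathcal{H}_{p,k}:=\prod_{\ell=1}^k(\mathcal{U}^{(p)}_{k,\ell})^{\mathbb{N}}$ with product topology and product cubes (a map to the product is a cube iff each coordinate is). $\hom(\mathcal{D}_1(\mathbb{F}_p^\omega),\mathcal{H}_{p,k})$ is the set of all morphisms, with the subspace topology from the product space $\mathcal{H}_{p,k}^{\mathbb{F}_p^\omega}$; $z\in\mathbb{F}_p^\omega$ acts by the shift $f\mapsto f(\cdot+z)$. $\mathrm{orb}(f)$ is the orbit of $f$ under this action and $\overline{\mathrm{orb}(f)}$ its closure. *)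

theory Defs
  imports
    "HOL-Analysis.Analysis"
    "HOL-Algebra.FiniteProduct"
    "HOL-Algebra.Group_Action"
    "HOL-Algebra.Product_Groups"
    "HOL-Computational_Algebra.Primes"
begin

text \<open>Abelian groups are those of HOL-Algebra, hence written multiplicatively:
  \<open>\<otimes>\<close> is the addition of the mathematical text and \<open>x [^] m\<close> is the multiple \<open>m x\<close>.
  Countable direct sums and powers are indexed by all of \<^typ>\<open>nat\<close>, so indices start at 0.
  Functions with a restricted domain are extensional, i.e. \<open>undefined\<close> outside of it.\<close>

definition Fp_omega :: "nat \<Rightarrow> (nat \<Rightarrow> int) monoid" where
  "Fp_omega p = sum_group UNIV (\<lambda>_. integer_mod_group p)"


subsection \<open>Topological dynamical systems\<close>

definition continuous_action ::
  "('g, 'b) monoid_scheme \<Rightarrow> 'a topology \<Rightarrow> ('g \<Rightarrow> 'a \<Rightarrow> 'a) \<Rightarrow> bool" where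
  "continuous_action G X \<alpha> \<longleftrightarrow>
     group_action G (topspace X) \<alpha> \<and>
     continuous_map (prod_topology (discrete_topology (carrier G)) X) X (\<lambda>(z, x). \<alpha> z x)"

definition transitive_system ::
  "('g, 'b) monoid_scheme \<Rightarrow> 'a topology \<Rightarrow> ('g \<Rightarrow> 'a \<Rightarrow> 'a) \<Rightarrow> bool" where
  "transitive_system G X \<alpha> \<longleftrightarrow>
     (\<exists>x \<in> topspace X. X closure_of (orbit G \<alpha> x) = topspace X)"

definition conjugate_systems ::
  "('g, 'b) monoid_scheme \<Rightarrow> 'x topology \<Rightarrow> ('g \<Rightarrow> 'x \<Rightarrow> 'x)
     \<Rightarrow> 'y topology \<Rightarrow> ('g \<Rightarrow> 'y \<Rightarrow> 'y) \<Rightarrow> bool" where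
  "conjugate_systems G X \<alpha> Y \<beta> \<longleftrightarrow>
     (\<exists>h. homeomorphic_map X Y h \<and>
          (\<forall>z \<in> carrier G. \<forall>x \<in> topspace X. h (\<alpha> z x) = \<beta> z (h x)))"

definition mult_deriv ::
  "('g \<Rightarrow> 'a \<Rightarrow> 'a) \<Rightarrow> 'g \<Rightarrow> ('a \<Rightarrow> complex) \<Rightarrow> 'a \<Rightarrow> complex" where
  "mult_deriv \<alpha> z \<phi> = (\<lambda>y. \<phi> (\<alpha> z y) * cnj (\<phi> y))"

definition phase_polynomials ::
  "('g, 'b) monoid_scheme \<Rightarrow> 'a topology \<Rightarrow> ('g \<Rightarrow> 'a \<Rightarrow> 'a) \<Rightarrow> nat \<Rightarrow> ('a \<Rightarrow> complex) set" where
  "phase_polynomials G X \<alpha> k =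
     {\<phi>. continuous_map X euclidean \<phi> \<and>
         (\<forall>zs. length zs = k + 1 \<and> set zs \<subseteq> carrier G \<longrightarrow>
            (\<forall>y \<in> topspace X. foldr (mult_deriv \<alpha>) zs \<phi> y = 1))}"

inductive_set generated_algebra :: "('a \<Rightarrow> complex) set \<Rightarrow> ('a \<Rightarrow> complex) set"
  for P :: "('a \<Rightarrow> complex) set" where
  gen: "\<phi> \<in> P \<Longrightarrow> \<phi> \<in> generated_algebra P"
| scale: "\<phi> \<in> generated_algebra P \<Longrightarrow> (\<lambda>x. c * \<phi> x) \<in> generated_algebra P"
| add: "\<phi> \<in> generated_algebra P \<Longrightarrow> \<psi> \<in> generated_algebra P
    \<Longrightarrow> (\<lambda>x. \<phi> x + \<psi> x) \<in> generated_algebra P"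
| mult: "\<phi> \<in> generated_algebra P \<Longrightarrow> \<psi> \<in> generated_algebra P
    \<Longrightarrow> (\<lambda>x. \<phi> x * \<psi> x) \<in> generated_algebra P"

definition topological_Abramov ::
  "('g, 'b) monoid_scheme \<Rightarrow> 'a topology \<Rightarrow> ('g \<Rightarrow> 'a \<Rightarrow> 'a) \<Rightarrow> nat \<Rightarrow> bool" where
  "topological_Abramov G X \<alpha> k \<longleftrightarrow>
     (\<forall>F. continuous_map X euclidean F \<longrightarrow>
        (\<forall>\<epsilon>>0. \<exists>\<phi> \<in> generated_algebra (phase_polynomials G X \<alpha> k).
            \<forall>x \<in> topspace X. norm (F x - \<phi> x) < \<epsilon>))"


subsection \<open>Group nilspaces and morphisms\<close>

text \<open>A vertex of the discrete \<open>n\<close>-cube is a 0-1-valued function on \<open>{1..n}\<close>.\<close>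

definition discrete_cube :: "nat \<Rightarrow> (nat \<Rightarrow> nat) set" where
  "discrete_cube n = {1..n} \<rightarrow>\<^sub>E {0, 1}"

record 'a nilspace =
  points :: "'a set"
  cubes :: "nat \<Rightarrow> ((nat \<Rightarrow> nat) \<Rightarrow> 'a) set"

definition group_nilspace :: "('a, 'b) monoid_scheme \<Rightarrow> (nat \<Rightarrow> 'a set) \<Rightarrow> 'a nilspace" where
  "group_nilspace G Gf = \<lparr>
     points = carrier G,
     cubes = (\<lambda>n. {c. \<exists>g. (\<forall>S \<subseteq> {1..n}. g S \<in> Gf (card S)) \<and>
        c = (\<lambda>v \<in> discrete_cube n.
               finprod G (\<lambda>S. g S [^]\<^bsub>G\<^esub> (\<Prod>i\<in>S. v i)) (Pow {1..n}))}) \<rparr>"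

definition D1 :: "('a, 'b) monoid_scheme \<Rightarrow> 'a nilspace" where
  "D1 Z = group_nilspace Z (\<lambda>i. if i \<le> 1 then carrier Z else {\<one>\<^bsub>Z\<^esub>})"

definition prod_nilspace :: "'i set \<Rightarrow> ('i \<Rightarrow> 'a nilspace) \<Rightarrow> ('i \<Rightarrow> 'a) nilspace" where
  "prod_nilspace I N = \<lparr>
     points = (\<Pi>\<^sub>E i\<in>I. points (N i)),
     cubes = (\<lambda>n. {c \<in> discrete_cube n \<rightarrow>\<^sub>E (\<Pi>\<^sub>E i\<in>I. points (N i)).
        \<forall>i \<in> I. (\<lambda>v \<in> discrete_cube n. c v i) \<in> cubes (N i) n}) \<rparr>"

definition nilspace_hom :: "'a nilspace \<Rightarrow> 'b nilspace \<Rightarrow> ('a \<Rightarrow> 'b) set" where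
  "nilspace_hom N M =
     {f \<in> points N \<rightarrow>\<^sub>E points M.
        \<forall>n. \<forall>c \<in> cubes N n. (\<lambda>v \<in> discrete_cube n. f (c v)) \<in> cubes M n}"


subsection \<open>The nilspace \<open>\<H>\<^bsub>p,k\<^esub>\<close> and the shift system of morphisms\<close>

definition U_group :: "nat \<Rightarrow> nat \<Rightarrow> nat \<Rightarrow> int monoid" where
  "U_group p k l = integer_mod_group (p ^ ((k - l) div (p - 1) + 1))"

text \<open>The natural-number subtractions do not truncate, since only \<open>1 \<le> l \<le> k\<close> is used.\<close>

definition U_filtration :: "nat \<Rightarrow> nat \<Rightarrow> nat \<Rightarrow> nat \<Rightarrow> int set" where
  "U_filtration p k l i =
     (if i \<le> l then carrier (U_group p k l)
      else (\<lambda>x. x [^]\<^bsub>U_group p k l\<^esub> (p ^ ((i - l - 1) div (p - 1) + 1))) ` carrier (U_group p k l))"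

definition U_nilspace :: "nat \<Rightarrow> nat \<Rightarrow> nat \<Rightarrow> int nilspace" where
  "U_nilspace p k l = group_nilspace (U_group p k l) (U_filtration p k l)"

text \<open>The factor with index \<open>(l, m)\<close> is the \<open>m\<close>-th copy of \<open>\<U>\<^bsub>k,l\<^esub>\<close>.\<close>

definition H_nilspace :: "nat \<Rightarrow> nat \<Rightarrow> (nat \<times> nat \<Rightarrow> int) nilspace" where
  "H_nilspace p k = prod_nilspace ({1..k} \<times> UNIV) (\<lambda>(l, m). U_nilspace p k l)"

definition H_topology :: "nat \<Rightarrow> nat \<Rightarrow> (nat \<times> nat \<Rightarrow> int) topology" where
  "H_topology p k =
     product_topology (\<lambda>(l, m). discrete_topology (points (U_nilspace p k l))) ({1..k} \<times> UNIV)"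

definition hom_D1_H :: "nat \<Rightarrow> nat \<Rightarrow> ((nat \<Rightarrow> int) \<Rightarrow> nat \<times> nat \<Rightarrow> int) set" where
  "hom_D1_H p k = nilspace_hom (D1 (Fp_omega p)) (H_nilspace p k)"

definition hom_topology :: "nat \<Rightarrow> nat \<Rightarrow> ((nat \<Rightarrow> int) \<Rightarrow> nat \<times> nat \<Rightarrow> int) topology" where
  "hom_topology p k =
     subtopology (product_topology (\<lambda>_. H_topology p k) (carrier (Fp_omega p))) (hom_D1_H p k)"

definition shift :: "('a, 'b) monoid_scheme \<Rightarrow> 'a \<Rightarrow> ('a \<Rightarrow> 'c) \<Rightarrow> 'a \<Rightarrow> 'c" where
  "shift G z f = (\<lambda>x \<in> carrier G. f (x \<otimes>\<^bsub>G\<^esub> z))"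

definition orbit_closure ::
  "nat \<Rightarrow> nat \<Rightarrow> ((nat \<Rightarrow> int) \<Rightarrow> nat \<times> nat \<Rightarrow> int)
     \<Rightarrow> ((nat \<Rightarrow> int) \<Rightarrow> nat \<times> nat \<Rightarrow> int) topology" where
  "orbit_closure p k f =
     subtopology (hom_topology p k)
       (hom_topology p k closure_of orbit (Fp_omega p) (shift (Fp_omega p)) f)"

end

theory Submission
  imports Defs
begin

text \<open>
  Along a dense orbit, a phase polynomial \<open>\<phi>\<close> of degree at most \<open>k\<close> becomes a function \<open>\<theta>\<close> from the
  group to the circle whose \<open>(k+1)\<close>-fold differences vanish. Since the group has exponent \<open>p\<close>, the
  translation \<open>1 + \<Delta>\<^sub>h\<close> has \<open>p\<close>-th power 1, and expanding this power expresses \<open>p \<Delta>\<^sub>h\<close> through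
  \<open>\<Delta>\<^sub>h\<^sup>p\<close> and the terms \<open>p \<Delta>\<^sub>h\<^sup>j\<close> with \<open>j \<ge> 2\<close>. Hence multiplication by \<open>p\<close> lowers the degree by
  \<open>p - 1\<close> (\<open>prime_mult_lowers_degree\<close>). Put \<open>q = \<lfloor>(k-1)/(p-1)\<rfloor>\<close>. Then \<open>p\<^sup>q\<^sup>+\<^sup>1 \<theta>\<close> is constant, so after
  normalisation \<open>\<phi>\<close> takes values in the roots of unity of order \<open>p\<^sup>q\<^sup>+\<^sup>1\<close>, on the orbit and hence
  everywhere. The same fact bounds the order of every iterated difference of \<open>\<theta>\<close>, and at the level
  \<open>l = k - q(p-1)\<close> these bounds are exactly the filtration of \<open>\<U>\<^sub>k\<^sub>,\<^sub>l\<close>, a cyclic group of order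
  \<open>p\<^sup>q\<^sup>+\<^sup>1\<close> (\<open>polynomial_respects_top_filtration\<close>). The link with cubes is Newton's expansion:
  a function into a cyclic group is a morphism on \<open>\<D>\<^sub>1\<close> iff its \<open>i\<close>-fold differences lie in the
  \<open>i\<close>-th term of the filtration (\<open>cyclic_hom_iff\<close>).

  For a transitive Abramov system the phase polynomials separate points, and by second countability
  countably many \<open>\<phi>\<^sub>m\<close> do. Recording the values \<open>\<phi>\<^sub>m(z \<cdot> y)\<close>, coded as residues, in the copies of
  \<open>\<U>\<^sub>k\<^sub>,\<^sub>l\<close> for this single \<open>l\<close>, and 0 at all other levels, sends each point \<open>y\<close> to a morphism. The map
  is continuous, injective and equivariant, so it identifies the compact system with the closure of
  the orbit of the image of a point with dense orbit.

  Conversely, composing the coordinates of an orbit closure with characters gives phase polynomials,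
  because the filtration of \<open>\<U>\<^sub>k\<^sub>,\<^sub>l\<close> vanishes at index \<open>k + 1\<close>. They separate points and have finitely many
  values, so interpolation puts the indicators of enough clopen sets into the generated algebra to
  approximate every continuous function by step functions (\<open>generated_algebra_dense\<close>).
\<close>

section \<open>Differences on a group of prime exponent\<close>

definition gdiff :: "('g, 'b) monoid_scheme \<Rightarrow> 'g \<Rightarrow> ('g \<Rightarrow> 'v::ab_group_add) \<Rightarrow> 'g \<Rightarrow> 'v" where
  "gdiff G h P = (\<lambda>x. P (x \<otimes>\<^bsub>G\<^esub> h) - P x)"

abbreviation iter_gdiff ::
  "('g, 'b) monoid_scheme \<Rightarrow> 'g list \<Rightarrow> ('g \<Rightarrow> 'v::ab_group_add) \<Rightarrow> 'g \<Rightarrow> 'v" where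
  "iter_gdiff G hs P \<equiv> foldr (gdiff G) hs P"

lemma iter_gdiff_cmult:
  fixes P :: "'g \<Rightarrow> 'v::ring"
  shows "iter_gdiff G hs (\<lambda>x. c * P x) = (\<lambda>x. c * iter_gdiff G hs P x)"
  by (induction hs) (auto simp: gdiff_def algebra_simps)

lemma iter_gdiff_of_int_divide:
  "iter_gdiff G hs (\<lambda>x. real_of_int (P x) / c) = (\<lambda>x. real_of_int (iter_gdiff G hs P x) / c)"
  by (induction hs) (auto simp: gdiff_def diff_divide_distrib)

lemma (in monoid) iter_gdiff_cong:
  assumes "\<And>x. x \<in> carrier G \<Longrightarrow> P x = Q x" "set hs \<subseteq> carrier G" "x \<in> carrier G"
  shows "iter_gdiff G hs P x = iter_gdiff G hs Q x"
  using assms(2,3) by (induction hs arbitrary: x) (auto simp: gdiff_def assms(1))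

lemma (in comm_monoid) iter_gdiff_translate:
  assumes "z \<in> carrier G" "set hs \<subseteq> carrier G" "x \<in> carrier G"
  shows "iter_gdiff G hs (\<lambda>w. P (w \<otimes> z)) x = iter_gdiff G hs P (x \<otimes> z)"
  using assms(2,3)
proof (induction hs arbitrary: x)
  case (Cons h hs)
  then have "x \<otimes> h \<otimes> z = x \<otimes> z \<otimes> h"
    using assms(1) by (simp add: m_ac)
  with Cons show ?case by (simp add: gdiff_def)
qed simp

lemma (in monoid) iter_gdiff_in_Ints_mono:
  fixes P :: "'a \<Rightarrow> real"
  assumes "\<And>hs x. set hs \<subseteq> carrier G \<Longrightarrow> length hs = n \<Longrightarrow> x \<in> carrier G \<Longrightarrow> iter_gdiff G hs P x \<in> \<int>"
    and "set hs \<subseteq> carrier G" "n \<le> length hs" "x \<in> carrier G"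
  shows "iter_gdiff G hs P x \<in> \<int>"
  using assms(2-)
proof (induction hs arbitrary: x)
  case Nil
  then show ?case using assms(1)[of "[]"] by simp
next
  case (Cons h hs)
  show ?case
  proof (cases "n \<le> length hs")
    case True
    with Cons show ?thesis by (simp add: gdiff_def)
  next
    case False
    with Cons.prems have "length (h # hs) = n" by simp
    with Cons.prems show ?thesis using assms(1) by blast
  qed
qed

text \<open>
  Translation by \<open>h\<close> is the operator \<open>1 + \<Delta>\<^sub>h\<close>, so this is the binomial theorem for its
  \<open>m\<close>-th power.
\<close>

lemma (in monoid) shift_power_binomial:
  fixes R :: "'a \<Rightarrow> 'v::ring_1"
  assumes "h \<in> carrier G" "x \<in> carrier G"
  shows "R (x \<otimes> h [^] (m::nat)) = (\<Sum>j\<le>m. of_nat (m choose j) * (gdiff G h ^^ j) R x)"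
proof (induction m arbitrary: R)
  case 0
  then show ?case using assms by simp
next
  case (Suc m)
  define d where "d j = (gdiff G h ^^ j) R x" for j
  have dS: "(gdiff G h ^^ j) (gdiff G h R) x = d (Suc j)" for j
    by (simp add: d_def funpow_swap1)
  have "R (x \<otimes> h [^] Suc m) = R (x \<otimes> h [^] m) + gdiff G h R (x \<otimes> h [^] m)"
    using assms by (simp add: gdiff_def m_assoc)
  also have "\<dots> = (\<Sum>j\<le>m. of_nat (m choose j) * d j) + (\<Sum>j\<le>m. of_nat (m choose j) * d (Suc j))"
    using Suc[of R] Suc[of "gdiff G h R"] by (simp add: dS flip: d_def)
  also have "(\<Sum>j\<le>m. of_nat (m choose j) * d j) = (\<Sum>j\<le>Suc m. of_nat (m choose j) * d j)"
    by (simp add: binomial_eq_0)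
  also have "\<dots> = d 0 + (\<Sum>j\<le>m. of_nat (m choose Suc j) * d (Suc j))"
    by (subst sum.atMost_Suc_shift) simp
  also have "\<dots> + (\<Sum>j\<le>m. of_nat (m choose j) * d (Suc j))
      = d 0 + (\<Sum>j\<le>m. of_nat (Suc m choose Suc j) * d (Suc j))"
    by (simp add: sum.distrib algebra_simps)
  also have "\<dots> = (\<Sum>j\<le>Suc m. of_nat (Suc m choose j) * d j)"
    unfolding sum.atMost_Suc_shift[of _ m] by simp
  finally show ?case by (simp add: d_def)
qed

text \<open>
  The circle is represented by the reals modulo \<open>\<int>\<close>, so vanishing of a difference is membership
  in \<open>\<int>\<close>. Induct downwards on the number of differences. In \<open>(1 + \<Delta>\<^sub>h)\<^sup>p = 1\<close> the terms with
  \<open>2 \<le> j < p\<close> have coefficients divisible by \<open>p\<close> and contain more than one \<open>\<Delta>\<^sub>h\<close>, hence are covered by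
  the induction hypothesis, while \<open>\<Delta>\<^sub>h\<^sup>p\<close> raises the number of differences to at least \<open>n\<close>; only
  \<open>p \<Delta>\<^sub>h\<close> remains.
\<close>

lemma (in comm_group) prime_mult_lowers_degree:
  fixes P :: "'a \<Rightarrow> real"
  assumes "prime p"
    and exponent: "\<And>h. h \<in> carrier G \<Longrightarrow> h [^] p = \<one>"
    and P: "\<And>hs x. set hs \<subseteq> carrier G \<Longrightarrow> length hs = n \<Longrightarrow> x \<in> carrier G \<Longrightarrow> iter_gdiff G hs P x \<in> \<int>"
    and "set hs \<subseteq> carrier G" "hs \<noteq> []" "n \<le> length hs + (p - 1)" "x \<in> carrier G"
  shows "of_nat p * iter_gdiff G hs P x \<in> \<int>"
  using assms(4-)
proof (induction "n - length hs" arbitrary: hs rule: less_induct)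
  case less
  obtain h hs' where hs: "hs = h # hs'"
    using less.prems by (cases hs) auto
  show ?case
  proof (cases "n \<le> length hs")
    case True
    then have "iter_gdiff G hs P x \<in> \<int>"
      using iter_gdiff_in_Ints_mono[OF P, of n hs x] less.prems by blast
    then show ?thesis by (intro Ints_mult) auto
  next
    case False
    define d where "d j = (gdiff G h ^^ j) (iter_gdiff G hs' P) x" for j
    have d_eq: "d j = iter_gdiff G (replicate j h @ hs') P x" for j
      unfolding d_def by (induction j arbitrary: x) (auto simp: gdiff_def)
    have h: "h \<in> carrier G" "set (replicate j h @ hs') \<subseteq> carrier G" for j
      using less.prems hs by auto
    have p2: "2 \<le> p" using assms(1) by (rule prime_ge_2_nat)
    then obtain r where r: "p = Suc (Suc r)"
      by (metis add_2_eq_Suc le_Suc_ex)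
    have split: "(\<Sum>j\<le>Suc (Suc r). f j) = f 0 + f 1 + (\<Sum>j<r. f (j + 2)) + f (Suc (Suc r))"
      for f :: "nat \<Rightarrow> real"
      by (induction r) auto
    have "d 0 = iter_gdiff G hs' P (x \<otimes> h [^] p)"
      using less.prems h exponent by (simp add: d_def)
    also have "\<dots> = (\<Sum>j\<le>p. of_nat (p choose j) * d j)"
      unfolding d_def by (rule shift_power_binomial) (use less.prems h in auto)
    also have "\<dots> = d 0 + of_nat p * d 1 + (\<Sum>j<r. of_nat (p choose (j+2)) * d (j+2)) + d p"
      using split[of "\<lambda>j. of_nat (p choose j) * d j"] by (simp add: r)
    finally have eq: "of_nat p * d 1 = - (\<Sum>j<r. of_nat (p choose (j+2)) * d (j+2)) - d p"
      by simp
    have "of_nat (p choose (j+2)) * d (j+2) \<in> \<int>" if "j < r" for j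
    proof -
      have "p dvd p choose (j+2)"
        using that r by (intro dvd_choose_prime assms(1)) auto
      then obtain c where c: "p choose (j+2) = c * p"
        by (metis dvd_def mult.commute)
      have "of_nat p * d (j+2) \<in> \<int>"
        unfolding d_eq
        by (rule less.hyps) (use False hs less.prems h in auto)
      then show ?thesis unfolding c by (simp add: mult.assoc)
    qed
    moreover have "d p \<in> \<int>"
      unfolding d_eq
      by (rule iter_gdiff_in_Ints_mono[OF P]) (use h less.prems hs p2 in auto)
    ultimately have "of_nat p * d 1 \<in> \<int>"
      unfolding eq by (intro Ints_diff Ints_minus Ints_sum) auto
    then show ?thesis by (simp add: d_eq hs)
  qed
qed

lemma (in comm_group) prime_power_mult_lowers_degree:
  fixes P :: "'a \<Rightarrow> real"
  assumes "prime p"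
    and exponent: "\<And>h. h \<in> carrier G \<Longrightarrow> h [^] p = \<one>"
    and P: "\<And>hs x. set hs \<subseteq> carrier G \<Longrightarrow> length hs = n \<Longrightarrow> x \<in> carrier G \<Longrightarrow> iter_gdiff G hs P x \<in> \<int>"
    and "set hs \<subseteq> carrier G" "hs \<noteq> []" "n \<le> length hs + j * (p - 1)" "x \<in> carrier G"
  shows "of_nat p ^ j * iter_gdiff G hs P x \<in> \<int>"
  using assms(4-)
proof (induction j arbitrary: hs x)
  case 0
  then show ?case using iter_gdiff_in_Ints_mono[OF P, of n hs x] by simp
next
  case (Suc j)
  (* The maximum with 1 makes lists of length n' nonempty, as the induction hypothesis requires. *)
  define n' where "n' = max 1 (n - j * (p - 1))"
  have "of_nat p * iter_gdiff G hs (\<lambda>x. of_nat p ^ j * P x) x \<in> \<int>"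
  proof (rule prime_mult_lowers_degree[OF assms(1) exponent, where n = n'])
    fix hs' y assume "set hs' \<subseteq> carrier G" "length hs' = n'" "y \<in> carrier G"
    moreover from this have "hs' \<noteq> []" by (auto simp: n'_def)
    ultimately show "iter_gdiff G hs' (\<lambda>x. of_nat p ^ j * P x) y \<in> \<int>"
      unfolding iter_gdiff_cmult by (intro Suc.IH) (auto simp: n'_def)
  next
    have "1 \<le> length hs" using Suc.prems(2) by (cases hs) auto
    then show "n' \<le> length hs + (p - 1)" using Suc.prems(3) by (auto simp: n'_def)
  qed (use Suc.prems in auto)
  then show ?case by (simp add: iter_gdiff_cmult mult.assoc)
qed

section \<open>Cubes and Newton expansions\<close>

text \<open>
  The differences in the directions \<open>h i\<close>, \<open>i \<in> S\<close>, in the form of an alternating sum over the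
  vertices of the cube with corner \<open>x\<close>. In contrast to iteration along a list, it needs no
  order on \<open>S\<close>.
\<close>

definition mixed_diff :: "('g, 'b) monoid_scheme \<Rightarrow> ('i \<Rightarrow> 'g) \<Rightarrow> 'i set \<Rightarrow> ('g \<Rightarrow> 'v::ring_1) \<Rightarrow> 'g \<Rightarrow> 'v" where
  "mixed_diff G h S P x = (\<Sum>T \<in> Pow S. (- 1) ^ card (S - T) * P (x \<otimes>\<^bsub>G\<^esub> finprod G h T))"

lemma (in comm_monoid) mixed_diff_empty:
  "x \<in> carrier G \<Longrightarrow> mixed_diff G h {} P x = P x"
  by (simp add: mixed_diff_def)

lemma sum_Pow_insert:
  fixes f :: "'a set \<Rightarrow> 'b::comm_monoid_add"
  assumes "finite S" "i \<notin> S"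
  shows "sum f (Pow (insert i S)) = (\<Sum>T\<in>Pow S. f T) + (\<Sum>T\<in>Pow S. f (insert i T))"
proof -
  have "inj_on (insert i) (Pow S)"
    using assms(2) by (auto simp: inj_on_def)
  moreover have "Pow S \<inter> insert i ` Pow S = {}"
    using assms(2) by auto
  ultimately show ?thesis
    using assms(1) by (simp add: Pow_insert sum.union_disjoint sum.reindex)
qed

lemma (in comm_monoid) mixed_diff_insert:
  fixes P :: "'a \<Rightarrow> 'v::ring_1"
  assumes "finite S" "i \<notin> S" "h \<in> insert i S \<rightarrow> carrier G" "x \<in> carrier G"
  shows "mixed_diff G h (insert i S) P x = mixed_diff G h S P (x \<otimes> h i) - mixed_diff G h S P x"
proof -
  have 1: "(- 1) ^ card (insert i S - T) = (- 1 :: 'v) * (- 1) ^ card (S - T)" if "T \<in> Pow S" for T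
  proof -
    have "insert i S - T = insert i (S - T)" using that assms(2) by auto
    then show ?thesis using assms(1,2) by simp
  qed
  have 2: "insert i S - insert i T = S - T" for T
    using assms(2) by auto
  have 3: "x \<otimes> finprod G h (insert i T) = (x \<otimes> h i) \<otimes> finprod G h T" if "T \<in> Pow S" for T
  proof -
    have "finite T" "i \<notin> T" "h \<in> T \<rightarrow> carrier G" "h i \<in> carrier G"
      using that assms finite_subset by auto
    then show ?thesis using assms(4) by (simp add: m_assoc)
  qed
  have "mixed_diff G h (insert i S) P x
      = (\<Sum>T\<in>Pow S. (- 1) ^ card (insert i S - T) * P (x \<otimes> finprod G h T))
        + (\<Sum>T\<in>Pow S. (- 1) ^ card (insert i S - insert i T) * P (x \<otimes> finprod G h (insert i T)))"
    unfolding mixed_diff_def by (rule sum_Pow_insert[OF assms(1,2)])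
  also have "\<dots> = - mixed_diff G h S P x + mixed_diff G h S P (x \<otimes> h i)"
    unfolding mixed_diff_def 2 sum_negf[symmetric]
    by (intro arg_cong2[where f = "(+)"] sum.cong) (auto simp: 1 3)
  finally show ?thesis by simp
qed

text \<open>
  Translation by all \<open>h i\<close> is the composition of the operators \<open>1 + \<Delta>\<^bsub>h i\<^esub>\<close>; multiplying out gives
  one term for each subset of \<open>T\<close>.
\<close>

lemma (in comm_monoid) newton_expansion:
  assumes "finite T" "h \<in> T \<rightarrow> carrier G" "x \<in> carrier G"
  shows "(\<Sum>S\<in>Pow T. mixed_diff G h S P x) = P (x \<otimes> finprod G h T)"
  using assms
proof (induction T arbitrary: x rule: finite_induct)
  case empty
  then show ?case by (simp add: mixed_diff_empty)
next
  case (insert i T)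
  then have hi: "h i \<in> carrier G" and hT: "h \<in> T \<rightarrow> carrier G" by auto
  have "(\<Sum>S\<in>Pow (insert i T). mixed_diff G h S P x)
      = (\<Sum>S\<in>Pow T. mixed_diff G h S P x) + (\<Sum>S\<in>Pow T. mixed_diff G h (insert i S) P x)"
    by (rule sum_Pow_insert) (use insert in auto)
  also have "(\<Sum>S\<in>Pow T. mixed_diff G h (insert i S) P x)
      = (\<Sum>S\<in>Pow T. mixed_diff G h S P (x \<otimes> h i) - mixed_diff G h S P x)"
    by (intro sum.cong refl mixed_diff_insert) (use insert finite_subset in auto)
  also have "(\<Sum>S\<in>Pow T. mixed_diff G h S P x) + \<dots> = P ((x \<otimes> h i) \<otimes> finprod G h T)"
    using insert.IH[OF hT, of "x \<otimes> h i"] insert.prems hi by (simp add: sum_subtractf)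
  also have "\<dots> = P (x \<otimes> finprod G h (insert i T))"
    using insert hi hT by (simp add: m_assoc)
  finally show ?case .
qed

lemma (in comm_monoid) mixed_diff_eq_iter_gdiff:
  assumes "distinct is" "h \<in> set is \<rightarrow> carrier G" "x \<in> carrier G"
  shows "mixed_diff G h (set is) P x = iter_gdiff G (map h is) P x"
  using assms
proof (induction "is" arbitrary: x)
  case (Cons i "is")
  then have "h i \<in> carrier G" "h \<in> set is \<rightarrow> carrier G" by auto
  with Cons show ?case by (simp add: mixed_diff_insert gdiff_def)
qed (simp add: mixed_diff_empty)

text \<open>
  Sums over all subsets determine the summands, so cube coefficients can be compared with the
  Newton coefficients of the values.
\<close>

lemma moebius_unique_mod:
  fixes a b :: "'i set \<Rightarrow> int"
  assumes "finite S"
    and "\<And>T. T \<subseteq> S \<Longrightarrow> (\<Sum>U\<in>Pow T. a U) mod N = (\<Sum>U\<in>Pow T. b U) mod N"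
  shows "a S mod N = b S mod N"
  using assms
proof (induction S rule: finite_psubset_induct)
  case (psubset S)
  have IH: "a U mod N = b U mod N" if "U \<in> Pow S - {S}" for U
    using psubset.prems that by (intro psubset.IH) auto
  have split: "(\<Sum>U\<in>Pow S. c U) = c S + (\<Sum>U\<in>Pow S - {S}. c U)" for c :: "'i set \<Rightarrow> int"
    using psubset.hyps by (subst sum.remove[of _ S]) auto
  have "N dvd (a S + (\<Sum>U\<in>Pow S - {S}. a U)) - (b S + (\<Sum>U\<in>Pow S - {S}. b U))"
    using psubset.prems[of S] by (simp add: mod_eq_dvd_iff split)
  moreover have "N dvd (\<Sum>U\<in>Pow S - {S}. a U - b U)"
    using IH by (intro dvd_sum) (simp add: mod_eq_dvd_iff)
  ultimately have "N dvd ((a S + (\<Sum>U\<in>Pow S - {S}. a U)) - (b S + (\<Sum>U\<in>Pow S - {S}. b U)))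
      - (\<Sum>U\<in>Pow S - {S}. a U - b U)"
    by (rule dvd_diff)
  then show ?case by (simp add: mod_eq_dvd_iff sum_subtractf)
qed

text \<open>
  Identifies the vertices of the discrete cube with the subsets of \<open>{1..n}\<close>.
\<close>

definition cube_support :: "nat \<Rightarrow> (nat \<Rightarrow> nat) \<Rightarrow> nat set" where
  "cube_support n v = {i \<in> {1..n}. v i = 1}"

lemma cube_support_subset: "cube_support n v \<subseteq> {1..n}"
  by (auto simp: cube_support_def)

lemma finite_cube_support [simp]: "finite (cube_support n v)"
  using cube_support_subset finite_subset by blast

lemma cube_support_surj:
  assumes "T \<subseteq> {1..n}"
  obtains v where "v \<in> discrete_cube n" "cube_support n v = T"
proof
  let ?v = "\<lambda>i\<in>{1..n}. if i \<in> T then 1 else 0 :: nat"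
  show "?v \<in> discrete_cube n" by (auto simp: discrete_cube_def)
  show "cube_support n ?v = T" using assms by (auto simp: cube_support_def)
qed

lemma prod_cube_vertex:
  assumes "v \<in> discrete_cube n" "S \<subseteq> {1..n}"
  shows "(\<Prod>i\<in>S. v i) = (if S \<subseteq> cube_support n v then 1 else 0)"
proof (cases "S \<subseteq> cube_support n v")
  case True
  then have "(\<Prod>i\<in>S. v i) = (\<Prod>i\<in>S. 1)"
    by (intro prod.cong) (auto simp: cube_support_def)
  with True show ?thesis by simp
next
  case False
  then obtain i where i: "i \<in> S" "i \<notin> cube_support n v" by auto
  with assms have "v i \<in> {0, 1}" by (auto simp: discrete_cube_def PiE_iff)
  with i assms(2) have "v i = 0" by (auto simp: cube_support_def)
  moreover have "finite S" using assms(2) finite_subset by blast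
  ultimately show ?thesis using i False by (auto intro: prod_zero)
qed

lemma group_nilspace_cube:
  fixes G (structure)
  assumes "comm_group G" "\<And>i. Gf i \<subseteq> carrier G"
  shows "c \<in> cubes (group_nilspace G Gf) n \<longleftrightarrow>
    (\<exists>g. (\<forall>S\<subseteq>{1..n}. g S \<in> Gf (card S)) \<and>
         c = (\<lambda>v\<in>discrete_cube n. finprod G g (Pow (cube_support n v))))"
proof -
  interpret comm_group G by fact
  have "finprod G (\<lambda>S. g S [^] (\<Prod>i\<in>S. v i)) (Pow {1..n}) = finprod G g (Pow (cube_support n v))"
    if g: "\<forall>S\<subseteq>{1..n}. g S \<in> Gf (card S)" and v: "v \<in> discrete_cube n" for g v
  proof -
    have gc: "g S \<in> carrier G" if "S \<subseteq> {1..n}" for S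
      using g that assms(2) by blast
    have "finprod G (\<lambda>S. g S [^] (\<Prod>i\<in>S. v i)) (Pow {1..n})
        = finprod G (\<lambda>S. if S \<subseteq> cube_support n v then g S else \<one>) (Pow {1..n})"
      using gc v by (intro finprod_cong') (auto simp: prod_cube_vertex)
    also have "\<dots> = finprod G g (Pow (cube_support n v))"
      using gc cube_support_subset[of n v]
      by (intro finprod_mono_neutral_cong_right) auto
    finally show ?thesis .
  qed
  then have eq: "(\<lambda>v\<in>discrete_cube n. finprod G (\<lambda>S. g S [^] (\<Prod>i\<in>S. v i)) (Pow {1..n}))
      = (\<lambda>v\<in>discrete_cube n. finprod G g (Pow (cube_support n v)))"
    if "\<forall>S\<subseteq>{1..n}. g S \<in> Gf (card S)" for g
    using that by (intro restrict_ext) auto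
  show ?thesis
    unfolding group_nilspace_def using eq by (simp cong: conj_cong)
qed

lemma D1_cube:
  fixes G (structure)
  assumes "comm_group G"
  shows "c \<in> cubes (D1 G) n \<longleftrightarrow>
    (\<exists>x\<in>carrier G. \<exists>h\<in>{1..n} \<rightarrow> carrier G.
       c = (\<lambda>v\<in>discrete_cube n. x \<otimes>\<^bsub>G\<^esub> finprod G h (cube_support n v)))"
proof -
  interpret comm_group G by fact
  let ?Gf = "\<lambda>i::nat. if i \<le> 1 then carrier G else {\<one>}"
  have affine: "finprod G g (Pow T) = g {} \<otimes> finprod G (\<lambda>i. g {i}) T"
    if g: "\<forall>S\<subseteq>{1..n}. g S \<in> ?Gf (card S)" and T: "T \<subseteq> {1..n}" for g T
  proof -
    have fin: "finite T" using T finite_subset by blast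
    have gc: "g S \<in> carrier G" if "S \<subseteq> {1..n}" for S
      using g[rule_format, OF that] by (auto split: if_splits)
    have "finprod G g (Pow T) = finprod G g (insert {} ((\<lambda>i. {i}) ` T))"
    proof (rule finprod_mono_neutral_cong_right)
      fix S assume S: "S \<in> Pow T - insert {} ((\<lambda>i. {i}) ` T)"
      then have "\<not> card S \<le> 1"
        using fin finite_subset[of S T] by (auto simp: card_le_Suc0_iff_eq)
      moreover have "S \<subseteq> {1..n}" using S T by auto
      ultimately show "g S = \<one>" using g[rule_format, of S] by simp
    qed (use T gc fin in auto)
    also have "\<dots> = g {} \<otimes> finprod G g ((\<lambda>i. {i}) ` T)"
      using T gc fin by (subst finprod_insert) auto
    also have "finprod G g ((\<lambda>i. {i}) ` T) = finprod G (\<lambda>i. g {i}) T"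
      using T gc by (subst finprod_reindex) auto
    finally show ?thesis .
  qed
  have "c \<in> cubes (D1 G) n \<longleftrightarrow>
    (\<exists>g. (\<forall>S\<subseteq>{1..n}. g S \<in> ?Gf (card S)) \<and>
         c = (\<lambda>v\<in>discrete_cube n. finprod G g (Pow (cube_support n v))))"
    unfolding D1_def by (rule group_nilspace_cube[OF assms]) auto
  also have "\<dots> \<longleftrightarrow> (\<exists>g. (\<forall>S\<subseteq>{1..n}. g S \<in> ?Gf (card S)) \<and>
         c = (\<lambda>v\<in>discrete_cube n. g {} \<otimes> finprod G (\<lambda>i. g {i}) (cube_support n v)))"
    by (intro ex_cong1 conj_cong refl arg_cong[where f = "\<lambda>d. c = d"] restrict_ext affine
        cube_support_subset)
  also have "\<dots> \<longleftrightarrow> (\<exists>x\<in>carrier G. \<exists>h\<in>{1..n} \<rightarrow> carrier G.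
       c = (\<lambda>v\<in>discrete_cube n. x \<otimes> finprod G h (cube_support n v)))" (is "?L \<longleftrightarrow> ?R")
  proof
    assume ?L
    then obtain g where g: "\<forall>S\<subseteq>{1..n}. g S \<in> ?Gf (card S)"
      and c: "c = (\<lambda>v\<in>discrete_cube n. g {} \<otimes> finprod G (\<lambda>i. g {i}) (cube_support n v))" by blast
    have "g {} \<in> carrier G" using g[rule_format, of "{}"] by simp
    moreover have "(\<lambda>i. g {i}) \<in> {1..n} \<rightarrow> carrier G"
    proof
      fix i assume "i \<in> {1..n}"
      then show "g {i} \<in> carrier G" using g[rule_format, of "{i}"] by simp
    qed
    ultimately show ?R using c by blast
  next
    assume ?R
    then obtain x h where x: "x \<in> carrier G" and h: "h \<in> {1..n} \<rightarrow> carrier G"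
      and c: "c = (\<lambda>v\<in>discrete_cube n. x \<otimes> finprod G h (cube_support n v))" by blast
    define g where "g S = (if S = {} then x else if is_singleton S then h (the_elem S) else \<one>)" for S
    have "\<forall>S\<subseteq>{1..n}. g S \<in> ?Gf (card S)"
    proof (intro allI impI)
      fix S :: "nat set" assume S: "S \<subseteq> {1..n}"
      then have "finite S" using finite_subset by blast
      then show "g S \<in> ?Gf (card S)"
        using S x h by (auto simp: g_def is_singleton_def is_singleton_altdef card_le_Suc0_iff_eq)
    qed
    moreover have "g {} \<otimes> finprod G (\<lambda>i. g {i}) (cube_support n v) = x \<otimes> finprod G h (cube_support n v)" for v
      by (simp add: g_def is_singleton_def)
    ultimately show ?L using c by (intro exI[of _ g]) simp
  qed
  finally show ?thesis .
qed

lemma D1_cube_in_points: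
  fixes G (structure)
  assumes "comm_group G" "c \<in> cubes (D1 G) n"
  shows "c \<in> discrete_cube n \<rightarrow> carrier G"
proof -
  interpret comm_group G by fact
  from assms(2)[unfolded D1_cube[OF assms(1)]] obtain x h where
    x: "x \<in> carrier G" and h: "h \<in> {1..n} \<rightarrow> carrier G"
    and c: "c = (\<lambda>v\<in>discrete_cube n. x \<otimes> finprod G h (cube_support n v))" by blast
  show ?thesis
    unfolding c using x h cube_support_subset by (fastforce intro!: m_closed finprod_closed)
qed

lemma finprod_integer_mod_group:
  assumes "N > 0" "finite A" "g \<in> A \<rightarrow> carrier (integer_mod_group N)"
  shows "finprod (integer_mod_group N) g A = (\<Sum>a\<in>A. g a) mod int N"
proof -
  interpret Z: comm_group "integer_mod_group N" by simp
  show ?thesis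
    using assms(2,3)
  proof (induction A rule: finite_induct)
    case (insert a A)
    then have "finprod (integer_mod_group N) g (insert a A) = (g a + (\<Sum>a\<in>A. g a) mod int N) mod int N"
      by (subst Z.finprod_insert) auto
    with insert.hyps show ?case by (simp add: mod_add_right_eq)
  qed simp
qed

text \<open>
  The image of the cube with corner \<open>x\<close> and edges \<open>h\<close> has a unique expansion over subsets, whose
  coefficients are the mixed differences of \<open>f\<close> (\<open>newton_expansion\<close>, \<open>moebius_unique_mod\<close>). So it
  is a cube iff these coefficients lie in the filtration, and every iterated difference is the top
  coefficient of some cube.
\<close>

lemma cyclic_hom_iff:
  fixes G (structure)
  assumes "comm_group G" "N > 0" and Gf: "\<And>i. Gf i \<subseteq> carrier (integer_mod_group N)"
    and f: "f \<in> carrier G \<rightarrow>\<^sub>E {0..<int N}"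
  shows "f \<in> nilspace_hom (D1 G) (group_nilspace (integer_mod_group N) Gf) \<longleftrightarrow>
    (\<forall>hs x. set hs \<subseteq> carrier G \<longrightarrow> x \<in> carrier G \<longrightarrow> iter_gdiff G hs f x mod int N \<in> Gf (length hs))"
    (is "?L \<longleftrightarrow> ?R")
proof -
  interpret comm_group G by fact
  have sum_eq: "finprod (integer_mod_group N) g (Pow T) = (\<Sum>S\<in>Pow T. g S) mod int N"
    if "\<forall>S\<subseteq>{1..n}. g S \<in> Gf (card S)" "T \<subseteq> {1..n}" for g T and n :: nat
  proof -
    have "finite T" using that(2) finite_subset by blast
    moreover have "g \<in> Pow T \<rightarrow> carrier (integer_mod_group N)"
    proof
      fix S assume "S \<in> Pow T"
      with that have "g S \<in> Gf (card S)" by auto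
      then show "g S \<in> carrier (integer_mod_group N)" using Gf by (rule rev_subsetD)
    qed
    ultimately show ?thesis using assms(2) by (intro finprod_integer_mod_group) auto
  qed
  have pts: "points (group_nilspace (integer_mod_group N) Gf) = {0..<int N}" "points (D1 G) = carrier G"
    using assms(2) by (simp_all add: group_nilspace_def carrier_integer_mod_group D1_def)
  (* A cube with corner x and edges h is mapped to a cube iff the values on its vertices
     have a Newton expansion with coefficients in the filtration. *)
  have cube_iff: "(\<lambda>v\<in>discrete_cube n. f ((\<lambda>v\<in>discrete_cube n. x \<otimes> finprod G h (cube_support n v)) v))
        \<in> cubes (group_nilspace (integer_mod_group N) Gf) n \<longleftrightarrow>
      (\<exists>g. (\<forall>S\<subseteq>{1..n}. g S \<in> Gf (card S)) \<and>
         (\<forall>T\<subseteq>{1..n}. f (x \<otimes> finprod G h T) = (\<Sum>S\<in>Pow T. g S) mod int N))" for n x h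
  proof -
    have "(\<lambda>v\<in>discrete_cube n. f ((\<lambda>v\<in>discrete_cube n. x \<otimes> finprod G h (cube_support n v)) v)) =
          (\<lambda>v\<in>discrete_cube n. finprod (integer_mod_group N) g (Pow (cube_support n v))) \<longleftrightarrow>
        (\<forall>T\<subseteq>{1..n}. f (x \<otimes> finprod G h T) = (\<Sum>S\<in>Pow T. g S) mod int N)"
      if g: "\<forall>S\<subseteq>{1..n}. g S \<in> Gf (card S)" for g
    proof -
      have "(\<lambda>v\<in>discrete_cube n. f ((\<lambda>v\<in>discrete_cube n. x \<otimes> finprod G h (cube_support n v)) v)) =
          (\<lambda>v\<in>discrete_cube n. finprod (integer_mod_group N) g (Pow (cube_support n v))) \<longleftrightarrow>
          (\<forall>v\<in>discrete_cube n. f (x \<otimes> finprod G h (cube_support n v))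
             = (\<Sum>S\<in>Pow (cube_support n v). g S) mod int N)"
        using sum_eq[OF g] cube_support_subset by (auto simp: fun_eq_iff restrict_def)
      also have "\<dots> \<longleftrightarrow> (\<forall>T\<subseteq>{1..n}. f (x \<otimes> finprod G h T) = (\<Sum>S\<in>Pow T. g S) mod int N)"
        using cube_support_surj cube_support_subset by metis
      finally show ?thesis .
    qed
    then show ?thesis
      unfolding group_nilspace_cube[OF abelian_integer_mod_group Gf] by blast
  qed
  define Q where "Q n c \<longleftrightarrow> (\<lambda>v\<in>discrete_cube n. f (c v))
      \<in> cubes (group_nilspace (integer_mod_group N) Gf) n" for n c
  have "?L \<longleftrightarrow> (\<forall>n. \<forall>c\<in>cubes (D1 G) n. Q n c)"
    using f by (simp add: nilspace_hom_def pts Q_def)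
  also have "\<dots> \<longleftrightarrow> (\<forall>n::nat. \<forall>x\<in>carrier G. \<forall>h\<in>{1..n} \<rightarrow> carrier G.
      Q n (\<lambda>v\<in>discrete_cube n. x \<otimes> finprod G h (cube_support n v)))"
    by (fastforce simp: D1_cube[OF assms(1)])
  also have "\<dots> \<longleftrightarrow> (\<forall>n::nat. \<forall>x\<in>carrier G. \<forall>h\<in>{1..n} \<rightarrow> carrier G.
      \<exists>g. (\<forall>S\<subseteq>{1..n}. g S \<in> Gf (card S)) \<and>
         (\<forall>T\<subseteq>{1..n}. f (x \<otimes> finprod G h T) = (\<Sum>S\<in>Pow T. g S) mod int N))"
    by (simp only: Q_def cube_iff)
  also have "\<dots> \<longleftrightarrow> ?R"
  proof (intro iffI allI impI ballI)
    fix hs x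
    assume L: "\<forall>n::nat. \<forall>x\<in>carrier G. \<forall>h\<in>{1..n} \<rightarrow> carrier G.
      \<exists>g. (\<forall>S\<subseteq>{1..n}. g S \<in> Gf (card S)) \<and>
         (\<forall>T\<subseteq>{1..n}. f (x \<otimes> finprod G h T) = (\<Sum>S\<in>Pow T. g S) mod int N)"
      and hs: "set hs \<subseteq> carrier G" and x: "x \<in> carrier G"
    define n where "n = length hs"
    define h where "h i = hs ! (i - 1)" for i
    have map_h: "map h [1..<Suc n] = hs"
      by (rule nth_equalityI) (auto simp: h_def n_def simp del: upt_Suc)
    have h: "h \<in> {1..n} \<rightarrow> carrier G"
      using hs by (auto simp: h_def n_def intro!: subsetD[OF hs] nth_mem)
    obtain g where g: "\<forall>S\<subseteq>{1..n}. g S \<in> Gf (card S)"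
      and fg: "\<And>T. T \<subseteq> {1..n} \<Longrightarrow> f (x \<otimes> finprod G h T) = (\<Sum>S\<in>Pow T. g S) mod int N"
      using L x h by meson
    have "mixed_diff G h {1..n} f x mod int N = g {1..n} mod int N"
    proof (rule moebius_unique_mod)
      fix T assume T: "T \<subseteq> {1..n}"
      then have "finite T" "h \<in> T \<rightarrow> carrier G" using h finite_subset by auto
      then have "(\<Sum>S\<in>Pow T. mixed_diff G h S f x) = f (x \<otimes> finprod G h T)"
        using x by (intro newton_expansion)
      then show "(\<Sum>S\<in>Pow T. mixed_diff G h S f x) mod int N = (\<Sum>S\<in>Pow T. g S) mod int N"
        using fg[OF T] by simp
    qed simp
    also have "\<dots> = g {1..n}"
    proof -
      have "g {1..n} \<in> carrier (integer_mod_group N)"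
        using g[rule_format, of "{1..n}"] Gf[of n] by auto
      then show ?thesis using assms(2) by (simp add: carrier_integer_mod_group)
    qed
    also have "\<dots> \<in> Gf n" using g[rule_format, of "{1..n}"] by simp
    also have "mixed_diff G h {1..n} f x = iter_gdiff G hs f x"
      using mixed_diff_eq_iter_gdiff[of "[1..<Suc n]" h x f] h x map_h
      by (simp add: atLeastLessThanSuc_atLeastAtMost del: upt_Suc)
    finally show "iter_gdiff G hs f x mod int N \<in> Gf (length hs)" by (simp add: n_def)
  next
    fix n :: nat and x h
    assume R: "\<forall>hs x. set hs \<subseteq> carrier G \<longrightarrow> x \<in> carrier G \<longrightarrow> iter_gdiff G hs f x mod int N \<in> Gf (length hs)"
      and x: "x \<in> carrier G" and h: "h \<in> {1..n} \<rightarrow> carrier G"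
    define g where "g S = mixed_diff G h S f x mod int N" for S
    have "g S \<in> Gf (card S)" if S: "S \<subseteq> {1..n}" for S
    proof -
      have fin: "finite S" using S finite_subset by blast
      let ?is = "sorted_list_of_set S"
      have "mixed_diff G h (set ?is) f x = iter_gdiff G (map h ?is) f x"
        by (rule mixed_diff_eq_iter_gdiff) (use fin S h x in auto)
      moreover have "iter_gdiff G (map h ?is) f x mod int N \<in> Gf (length (map h ?is))"
        using R x h S fin by (intro R[rule_format]) auto
      ultimately show ?thesis using fin by (simp add: g_def)
    qed
    moreover have "f (x \<otimes> finprod G h T) = (\<Sum>S\<in>Pow T. g S) mod int N" if T: "T \<subseteq> {1..n}" for T
    proof -
      have fT: "finite T" "h \<in> T \<rightarrow> carrier G" using h T finite_subset by auto
      then have "(\<Sum>S\<in>Pow T. g S) mod int N = f (x \<otimes> finprod G h T) mod int N"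
        unfolding g_def mod_sum_eq using x by (simp add: newton_expansion)
      also have "\<dots> = f (x \<otimes> finprod G h T)"
        using f fT x by (auto simp: PiE_iff)
      finally show ?thesis by simp
    qed
    ultimately show "\<exists>g. (\<forall>S\<subseteq>{1..n}. g S \<in> Gf (card S)) \<and>
         (\<forall>T\<subseteq>{1..n}. f (x \<otimes> finprod G h T) = (\<Sum>S\<in>Pow T. g S) mod int N)" by blast
  qed
  finally show ?thesis .
qed

lemma prod_nilspace_hom_iff:
  assumes "\<And>n c. c \<in> cubes N n \<Longrightarrow> c \<in> discrete_cube n \<rightarrow> points N"
  shows "f \<in> nilspace_hom N (prod_nilspace I M) \<longleftrightarrow>
    f \<in> points N \<rightarrow>\<^sub>E (\<Pi>\<^sub>E i\<in>I. points (M i)) \<and>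
    (\<forall>i\<in>I. (\<lambda>x\<in>points N. f x i) \<in> nilspace_hom N (M i))"
proof (cases "f \<in> points N \<rightarrow>\<^sub>E (\<Pi>\<^sub>E i\<in>I. points (M i))")
  case f: True
  have coords: "(\<lambda>x\<in>points N. f x i) \<in> points N \<rightarrow>\<^sub>E points (M i)" if "i \<in> I" for i
    using f that by (auto simp: PiE_iff)
  have eq: "(\<lambda>v\<in>discrete_cube n. (\<lambda>v\<in>discrete_cube n. f (c v)) v i)
      = (\<lambda>v\<in>discrete_cube n. (\<lambda>x\<in>points N. f x i) (c v))" if "c \<in> cubes N n" for n c i
    using assms[OF that] by (auto intro!: restrict_ext)
  have "(\<lambda>v\<in>discrete_cube n. f (c v)) \<in> discrete_cube n \<rightarrow>\<^sub>E (\<Pi>\<^sub>E i\<in>I. points (M i))"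
    if "c \<in> cubes N n" for n c
    using assms[OF that] f by (intro restrict_PiE_iff[THEN iffD2]) (auto simp: PiE_iff)
  then show ?thesis
    using f coords eq unfolding nilspace_hom_def prod_nilspace_def by auto
next
  case False
  then show ?thesis by (simp add: nilspace_hom_def prod_nilspace_def)
qed

section \<open>Algebras of finitely-valued functions\<close>

lemma generated_algebra_const:
  assumes "(\<lambda>_. 1) \<in> P"
  shows "(\<lambda>_. c) \<in> generated_algebra P"
  using generated_algebra.scale[OF generated_algebra.gen[OF assms], of c] by simp

lemma generated_algebra_diff:
  assumes "\<phi> \<in> generated_algebra P" "\<psi> \<in> generated_algebra P"
  shows "(\<lambda>x. \<phi> x - \<psi> x) \<in> generated_algebra P"
  using generated_algebra.add[OF assms(1) generated_algebra.scale[OF assms(2), of "- 1"]] by simp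

lemma generated_algebra_prod:
  assumes "(\<lambda>_. 1) \<in> P" "finite A" "\<And>a. a \<in> A \<Longrightarrow> \<phi> a \<in> generated_algebra P"
  shows "(\<lambda>x. \<Prod>a\<in>A. \<phi> a x) \<in> generated_algebra P"
  using assms(2,3)
proof (induction A rule: finite_induct)
  case empty
  then show ?case using generated_algebra.gen[OF assms(1)] by simp
next
  case (insert a A)
  then show ?case using generated_algebra.mult[of "\<phi> a" P "\<lambda>x. \<Prod>a\<in>A. \<phi> a x"] by simp
qed

text \<open>
  The sets whose indicator function agrees with an element of the algebra on the space. Agreement
  on the space suffices, as approximation is measured there.
\<close>

definition algebra_sets :: "'a topology \<Rightarrow> ('a \<Rightarrow> complex) set \<Rightarrow> 'a set set" where
  "algebra_sets X P = {C. \<exists>\<psi>\<in>generated_algebra P. \<forall>x\<in>topspace X. \<psi> x = of_bool (x \<in> C)}"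

lemma algebra_sets_UNIV:
  assumes "(\<lambda>_. 1) \<in> P"
  shows "UNIV \<in> algebra_sets X P"
  unfolding algebra_sets_def using generated_algebra_const[OF assms, of 1] by auto

lemma algebra_sets_Int:
  assumes "C \<in> algebra_sets X P" "D \<in> algebra_sets X P"
  shows "C \<inter> D \<in> algebra_sets X P"
proof -
  obtain \<phi> \<psi> where "\<phi> \<in> generated_algebra P" "\<forall>x\<in>topspace X. \<phi> x = of_bool (x \<in> C)"
    "\<psi> \<in> generated_algebra P" "\<forall>x\<in>topspace X. \<psi> x = of_bool (x \<in> D)"
    using assms unfolding algebra_sets_def by blast
  then show ?thesis
    unfolding algebra_sets_def using generated_algebra.mult[of \<phi> P \<psi>]
    by (auto intro!: bexI[of _ "\<lambda>x. \<phi> x * \<psi> x"])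
qed

lemma algebra_sets_INT:
  assumes "(\<lambda>_. 1) \<in> P" "finite I" "\<And>i. i \<in> I \<Longrightarrow> C i \<in> algebra_sets X P"
  shows "(\<Inter>i\<in>I. C i) \<in> algebra_sets X P"
  using assms(2,3)
  by (induction I rule: finite_induct) (auto simp: algebra_sets_UNIV[OF assms(1)] algebra_sets_Int)

text \<open>
  The indicator of a fibre is the Lagrange interpolation polynomial, on the finite set of values,
  that is 1 at \<open>v\<close> and 0 at the other values.
\<close>

lemma fiber_in_algebra_sets:
  assumes "(\<lambda>_. 1) \<in> P" "\<phi> \<in> P" "finite (\<phi> ` topspace X)"
  shows "{y. \<phi> y = v} \<in> algebra_sets X P"
proof -
  let ?V = "\<phi> ` topspace X - {v}"
  define \<psi> where "\<psi> y = (\<Prod>w\<in>?V. inverse (v - w) * (\<phi> y - w))" for y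
  have "\<psi> \<in> generated_algebra P"
    unfolding \<psi>_def using assms
    by (intro generated_algebra_prod generated_algebra.scale generated_algebra_diff
        generated_algebra.gen generated_algebra_const) auto
  moreover have "\<psi> y = of_bool (\<phi> y = v)" if y: "y \<in> topspace X" for y
  proof (cases "\<phi> y = v")
    case True
    have "\<psi> y = (\<Prod>w\<in>?V. 1)"
      unfolding \<psi>_def using True by (intro prod.cong) auto
    with True show ?thesis by simp
  next
    case False
    then have "\<psi> y = 0"
      unfolding \<psi>_def using y assms(3) by (intro prod_zero) auto
    with False show ?thesis by simp
  qed
  ultimately show ?thesis
    unfolding algebra_sets_def by (intro CollectI bexI[of _ \<psi>]) auto
qed

lemma closedin_fiber:
  fixes \<phi> :: "'a \<Rightarrow> complex"
  assumes "continuous_map X euclidean \<phi>"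
  shows "closedin X {y \<in> topspace X. \<phi> y = v}"
  using closedin_continuous_map_preimage[OF assms, of "{v}"] by simp

lemma openin_fiber:
  fixes \<phi> :: "'a \<Rightarrow> complex"
  assumes "continuous_map X euclidean \<phi>" "finite (\<phi> ` topspace X)"
  shows "openin X {y \<in> topspace X. \<phi> y = v}"
proof -
  have "openin X {y \<in> topspace X. \<phi> y \<in> - (\<phi> ` topspace X - {v})}"
  proof (rule openin_continuous_map_preimage[OF assms(1)])
    have "open (- (\<phi> ` topspace X - {v}))"
      using assms(2) by (intro open_Compl finite_imp_closed) auto
    then show "openin euclidean (- (\<phi> ` topspace X - {v}))" by simp
  qed
  also have "{y \<in> topspace X. \<phi> y \<in> - (\<phi> ` topspace X - {v})} = {y \<in> topspace X. \<phi> y = v}"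
    by auto
  finally show ?thesis .
qed

text \<open>
  Each point outside \<open>U\<close> is separated from \<open>x\<close> by a fibre through \<open>x\<close>; by compactness of the
  complement of \<open>U\<close>, finitely many fibres suffice, and the algebra is closed under products.
\<close>

lemma algebra_sets_neighbourhood:
  assumes "compact_space X" "(\<lambda>_. 1) \<in> P"
    and cont: "\<And>\<phi>. \<phi> \<in> P \<Longrightarrow> continuous_map X euclidean \<phi>"
    and fin: "\<And>\<phi>. \<phi> \<in> P \<Longrightarrow> finite (\<phi> ` topspace X)"
    and sep: "\<And>x y. x \<in> topspace X \<Longrightarrow> y \<in> topspace X \<Longrightarrow> x \<noteq> y \<Longrightarrow> \<exists>\<phi>\<in>P. \<phi> x \<noteq> \<phi> y"
    and U: "openin X U" "x \<in> U"
  obtains C where "C \<in> algebra_sets X P" "openin X (topspace X \<inter> C)" "x \<in> C" "topspace X \<inter> C \<subseteq> U"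
proof -
  have x: "x \<in> topspace X" using U openin_subset by blast
  have "compactin X (topspace X - U)"
    using assms(1) U(1) by (intro closedin_compact_space) auto
  moreover have "openin X {y \<in> topspace X. \<phi> y \<noteq> \<phi> x}" if "\<phi> \<in> P" for \<phi>
  proof -
    have "topspace X - {y \<in> topspace X. \<phi> y = \<phi> x} = {y \<in> topspace X. \<phi> y \<noteq> \<phi> x}" by auto
    then show ?thesis
      using closedin_fiber[OF cont[OF that], of "\<phi> x"] by (metis openin_diff openin_topspace)
  qed
  moreover have "topspace X - U \<subseteq> (\<Union>\<phi>\<in>P. {y \<in> topspace X. \<phi> y \<noteq> \<phi> x})"
  proof
    fix y assume "y \<in> topspace X - U"
    moreover from this have "y \<noteq> x" using U by auto
    ultimately show "y \<in> (\<Union>\<phi>\<in>P. {y \<in> topspace X. \<phi> y \<noteq> \<phi> x})"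
      using sep[of y x] x by auto
  qed
  ultimately have "\<exists>\<F>. finite \<F> \<and> \<F> \<subseteq> (\<lambda>\<phi>. {y \<in> topspace X. \<phi> y \<noteq> \<phi> x}) ` P \<and> topspace X - U \<subseteq> \<Union>\<F>"
    by (intro compactinD) auto
  then obtain Q where Q: "finite Q" "Q \<subseteq> P"
      "topspace X - U \<subseteq> (\<Union>\<phi>\<in>Q. {y \<in> topspace X. \<phi> y \<noteq> \<phi> x})"
    by (metis (no_types, lifting) finite_subset_image)
  define C where "C = (\<Inter>\<phi>\<in>Q. {y. \<phi> y = \<phi> x})"
  show ?thesis
  proof
    show "C \<in> algebra_sets X P"
      unfolding C_def using Q fin by (intro algebra_sets_INT fiber_in_algebra_sets assms(2)) auto
    have "openin X (\<Inter>\<phi>\<in>Q. {y \<in> topspace X. \<phi> y = \<phi> x})" if "Q \<noteq> {}"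
      using Q that cont fin by (intro openin_Inter) (auto intro!: openin_fiber)
    moreover have "(\<Inter>\<phi>\<in>Q. {y \<in> topspace X. \<phi> y = \<phi> x}) = topspace X \<inter> C" if "Q \<noteq> {}"
      using that by (auto simp: C_def)
    ultimately show "openin X (topspace X \<inter> C)"
      by (cases "Q = {}") (auto simp: C_def)
    show "x \<in> C" by (simp add: C_def)
    show "topspace X \<inter> C \<subseteq> U" using Q(3) by (auto simp: C_def)
  qed
qed

text \<open>
  Cover the space by finitely many sets from \<open>algebra_sets\<close> on which \<open>F\<close> varies by less than
  \<open>\<epsilon>\<close>, and build a step function by overwriting with a constant on one set after the other.
\<close>

lemma generated_algebra_dense:
  fixes F :: "'a \<Rightarrow> complex"
  assumes "compact_space X" "(\<lambda>_. 1) \<in> P"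
    and "\<And>\<phi>. \<phi> \<in> P \<Longrightarrow> continuous_map X euclidean \<phi>"
    and "\<And>\<phi>. \<phi> \<in> P \<Longrightarrow> finite (\<phi> ` topspace X)"
    and "\<And>x y. x \<in> topspace X \<Longrightarrow> y \<in> topspace X \<Longrightarrow> x \<noteq> y \<Longrightarrow> \<exists>\<phi>\<in>P. \<phi> x \<noteq> \<phi> y"
    and F: "continuous_map X euclidean F" and "\<epsilon> > 0"
  shows "\<exists>\<phi>\<in>generated_algebra P. \<forall>x\<in>topspace X. norm (F x - \<phi> x) < \<epsilon>"
proof -
  have "\<exists>C. C \<in> algebra_sets X P \<and> openin X (topspace X \<inter> C) \<and> x \<in> C \<and>
      (\<forall>y\<in>topspace X \<inter> C. norm (F y - F x) < \<epsilon>)" if x: "x \<in> topspace X" for x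
  proof -
    have "openin X {y \<in> topspace X. F y \<in> ball (F x) \<epsilon>}"
      by (rule openin_continuous_map_preimage[OF F]) auto
    moreover have "x \<in> {y \<in> topspace X. F y \<in> ball (F x) \<epsilon>}"
      using x \<open>\<epsilon> > 0\<close> by auto
    ultimately show ?thesis
      using algebra_sets_neighbourhood[OF assms(1-5)]
      by (smt (verit, ccfv_SIG) dist_norm mem_Collect_eq mem_ball norm_minus_commute subset_iff)
  qed
  then obtain C where C: "\<And>x. x \<in> topspace X \<Longrightarrow> C x \<in> algebra_sets X P"
    "\<And>x. x \<in> topspace X \<Longrightarrow> openin X (topspace X \<inter> C x)" "\<And>x. x \<in> topspace X \<Longrightarrow> x \<in> C x"
    "\<And>x y. x \<in> topspace X \<Longrightarrow> y \<in> topspace X \<Longrightarrow> y \<in> C x \<Longrightarrow> norm (F y - F x) < \<epsilon>"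
    by (metis IntI)
  have "\<exists>\<F>. finite \<F> \<and> \<F> \<subseteq> (\<lambda>x. topspace X \<inter> C x) ` topspace X \<and> topspace X \<subseteq> \<Union>\<F>"
    by (rule compactinD) (use assms(1) C in \<open>auto simp: compact_space_def\<close>)
  then obtain D where D: "finite D" "D \<subseteq> topspace X" "topspace X \<subseteq> (\<Union>x\<in>D. C x)"
    by (smt (verit, ccfv_SIG) IntD2 UN_iff finite_subset_image subset_iff)
  have "\<exists>\<phi>\<in>generated_algebra P. \<forall>y\<in>topspace X \<inter> (\<Union>x\<in>D. C x). norm (F y - \<phi> y) < \<epsilon>"
    using D(1,2)
  proof (induction D rule: finite_induct)
    case empty
    then show ?case using generated_algebra_const[OF assms(2)] by blast
  next
    case (insert x D)
    then obtain \<phi> where \<phi>: "\<phi> \<in> generated_algebra P"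
      "\<And>y. y \<in> topspace X \<Longrightarrow> y \<in> (\<Union>x\<in>D. C x) \<Longrightarrow> norm (F y - \<phi> y) < \<epsilon>" by auto
    have x: "x \<in> topspace X" using insert.prems by simp
    obtain \<theta> where \<theta>: "\<theta> \<in> generated_algebra P" "\<And>y. y \<in> topspace X \<Longrightarrow> \<theta> y = of_bool (y \<in> C x)"
      using C(1)[OF x] unfolding algebra_sets_def by blast
    define \<psi> where "\<psi> y = \<phi> y * (1 - \<theta> y) + F x * \<theta> y" for y
    have "\<psi> \<in> generated_algebra P"
      unfolding \<psi>_def using \<phi>(1) \<theta>(1) assms(2)
      by (intro generated_algebra.add generated_algebra.mult generated_algebra.scale
          generated_algebra_diff generated_algebra_const)
    moreover have "norm (F y - \<psi> y) < \<epsilon>"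
      if y: "y \<in> topspace X" "y \<in> (\<Union>x\<in>insert x D. C x)" for y
      using y \<phi>(2)[of y] C(4)[OF x, of y] by (cases "y \<in> C x") (auto simp: \<psi>_def \<theta>(2))
    ultimately show ?case by blast
  qed
  then show ?thesis using D(3) by blast
qed

section \<open>Morphisms into the nilspace \<open>\<H>\<^bsub>p,k\<^esub>\<close>\<close>

lemma comm_group_Fp_omega: "comm_group (Fp_omega p)"
  unfolding Fp_omega_def
  by (rule group.group_comm_groupI) (auto simp: add.commute)

lemma Fp_omega_pow_prime:
  assumes "p > 0" "h \<in> carrier (Fp_omega p)"
  shows "h [^]\<^bsub>Fp_omega p\<^esub> p = \<one>\<^bsub>Fp_omega p\<^esub>"
proof -
  have pow: "h [^]\<^bsub>Fp_omega p\<^esub> m = (\<lambda>i. (int m * h i) mod int p)" for m :: nat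
    by (induction m) (auto simp: Fp_omega_def fun_eq_iff algebra_simps mod_add_right_eq)
  show ?thesis by (auto simp: pow) (simp add: Fp_omega_def restrict_def)
qed

definition U_order :: "nat \<Rightarrow> nat \<Rightarrow> nat \<Rightarrow> nat" where
  "U_order p k l = p ^ ((k - l) div (p - 1) + 1)"

lemma U_order_pos: "prime p \<Longrightarrow> U_order p k l > 0"
  by (simp add: U_order_def prime_gt_0_nat)

lemma carrier_U_group: "prime p \<Longrightarrow> carrier (U_group p k l) = {0..<int (U_order p k l)}"
  using U_order_pos[of p k l] by (simp add: U_group_def carrier_integer_mod_group U_order_def prime_gt_0_nat)

lemma U_filtration_subset: "U_filtration p k l i \<subseteq> carrier (U_group p k l)"
proof -
  have "group (U_group p k l)" by (simp add: U_group_def)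
  then show ?thesis
    by (auto simp: U_filtration_def group.is_monoid monoid.nat_pow_closed)
qed

lemma points_U_nilspace: "prime p \<Longrightarrow> points (U_nilspace p k l) = {0..<int (U_order p k l)}"
  by (simp add: U_nilspace_def group_nilspace_def carrier_U_group)

lemma points_H_nilspace:
  assumes "prime p"
  shows "points (H_nilspace p k) = (\<Pi>\<^sub>E (l, m)\<in>{1..k} \<times> UNIV. {0..<int (U_order p k l)})"
  unfolding H_nilspace_def prod_nilspace_def
  by (auto simp: points_U_nilspace[OF assms] PiE_iff split: prod.splits)

lemma hom_D1_H_iff:
  fixes f :: "(nat \<Rightarrow> int) \<Rightarrow> nat \<times> nat \<Rightarrow> int"
  assumes "prime p"
  shows "f \<in> hom_D1_H p k \<longleftrightarrow>
    f \<in> carrier (Fp_omega p) \<rightarrow>\<^sub>E points (H_nilspace p k) \<and>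
    (\<forall>l\<in>{1..k}. \<forall>m hs x. set hs \<subseteq> carrier (Fp_omega p) \<longrightarrow> x \<in> carrier (Fp_omega p) \<longrightarrow>
       iter_gdiff (Fp_omega p) hs (\<lambda>x. f x (l, m)) x mod int (U_order p k l) \<in> U_filtration p k l (length hs))"
proof -
  interpret G: comm_group "Fp_omega p" by (rule comm_group_Fp_omega)
  let ?G = "Fp_omega p"
  have pts: "points (D1 ?G) = carrier ?G" by (simp add: D1_def group_nilspace_def)
  have "f \<in> hom_D1_H p k \<longleftrightarrow> f \<in> carrier ?G \<rightarrow>\<^sub>E points (H_nilspace p k) \<and>
    (\<forall>i\<in>{1..k} \<times> UNIV. (\<lambda>x\<in>carrier ?G. f x i) \<in> nilspace_hom (D1 ?G) (case i of (l, m) \<Rightarrow> U_nilspace p k l))"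
    unfolding hom_D1_H_def H_nilspace_def
    by (subst prod_nilspace_hom_iff) (auto simp: pts prod_nilspace_def dest!: D1_cube_in_points[OF comm_group_Fp_omega])
  also have "\<dots> \<longleftrightarrow> f \<in> carrier ?G \<rightarrow>\<^sub>E points (H_nilspace p k) \<and>
    (\<forall>l\<in>{1..k}. \<forall>m hs x. set hs \<subseteq> carrier ?G \<longrightarrow> x \<in> carrier ?G \<longrightarrow>
       iter_gdiff ?G hs (\<lambda>x. f x (l, m)) x mod int (U_order p k l) \<in> U_filtration p k l (length hs))"
  proof (rule conj_cong[OF refl])
    assume f: "f \<in> carrier ?G \<rightarrow>\<^sub>E points (H_nilspace p k)"
    have "(\<lambda>x\<in>carrier ?G. f x (l, m)) \<in> nilspace_hom (D1 ?G) (U_nilspace p k l) \<longleftrightarrow>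
      (\<forall>hs x. set hs \<subseteq> carrier ?G \<longrightarrow> x \<in> carrier ?G \<longrightarrow>
       iter_gdiff ?G hs (\<lambda>x. f x (l, m)) x mod int (U_order p k l) \<in> U_filtration p k l (length hs))"
      if l: "l \<in> {1..k}" for l m
    proof -
      have "f x (l, m) \<in> {0..<int (U_order p k l)}" if "x \<in> carrier ?G" for x
        using PiE_mem[OF PiE_mem[OF f that, unfolded points_H_nilspace[OF assms]], of "(l, m)"] l by simp
      then have "(\<lambda>x\<in>carrier ?G. f x (l, m)) \<in> nilspace_hom (D1 ?G) (U_nilspace p k l) \<longleftrightarrow>
        (\<forall>hs x. set hs \<subseteq> carrier ?G \<longrightarrow> x \<in> carrier ?G \<longrightarrow>
         iter_gdiff ?G hs (\<lambda>x\<in>carrier ?G. f x (l, m)) x mod int (U_order p k l) \<in> U_filtration p k l (length hs))"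
        unfolding U_nilspace_def U_group_def U_order_def[symmetric]
        by (intro cyclic_hom_iff comm_group_Fp_omega U_order_pos assms
            U_filtration_subset[unfolded U_group_def U_order_def[symmetric]]) auto
      also have "\<dots> \<longleftrightarrow> (\<forall>hs x. set hs \<subseteq> carrier ?G \<longrightarrow> x \<in> carrier ?G \<longrightarrow>
         iter_gdiff ?G hs (\<lambda>x. f x (l, m)) x mod int (U_order p k l) \<in> U_filtration p k l (length hs))"
        by (simp add: G.iter_gdiff_cong[of "\<lambda>x\<in>carrier ?G. f x (l, m)" "\<lambda>x. f x (l, m)"] cong: imp_cong)
      finally show ?thesis .
    qed
    then show "(\<forall>i\<in>{1..k} \<times> UNIV. (\<lambda>x\<in>carrier ?G. f x i) \<in> nilspace_hom (D1 ?G) (case i of (l, m) \<Rightarrow> U_nilspace p k l))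
      \<longleftrightarrow> (\<forall>l\<in>{1..k}. \<forall>m hs x. set hs \<subseteq> carrier ?G \<longrightarrow> x \<in> carrier ?G \<longrightarrow>
       iter_gdiff ?G hs (\<lambda>x. f x (l, m)) x mod int (U_order p k l) \<in> U_filtration p k l (length hs))"
      by auto
  qed
  finally show ?thesis .
qed

lemma hom_D1_H_coordinate:
  assumes "prime p" "f \<in> hom_D1_H p k" "l \<in> {1..k}" "x \<in> carrier (Fp_omega p)"
  shows "f x (l, m) \<in> {0..<int (U_order p k l)}"
proof -
  have "f x \<in> points (H_nilspace p k)"
    using assms(2,4) by (auto simp: hom_D1_H_iff[OF assms(1)])
  then have "f x (l, m) \<in> (case (l, m) of (l, m) \<Rightarrow> {0..<int (U_order p k l)})"
    unfolding points_H_nilspace[OF assms(1)] by (rule PiE_mem) (use assms(3) in auto)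
  then show ?thesis by simp
qed

text \<open>
  At index \<open>k + 1\<close> the filtration of \<open>\<U>\<^sub>k\<^sub>,\<^sub>l\<close> consists of the multiples of the order of the
  group, so coordinates of morphisms are polynomials of degree at most \<open>k\<close>.
\<close>

lemma hom_D1_H_degree:
  assumes "prime p" "f \<in> hom_D1_H p k" "l \<in> {1..k}"
    and "set hs \<subseteq> carrier (Fp_omega p)" "length hs = k + 1" "x \<in> carrier (Fp_omega p)"
  shows "int (U_order p k l) dvd iter_gdiff (Fp_omega p) hs (\<lambda>x. f x (l, m)) x"
proof -
  have "iter_gdiff (Fp_omega p) hs (\<lambda>x. f x (l, m)) x mod int (U_order p k l) \<in> U_filtration p k l (k + 1)"
    using assms(2-) unfolding hom_D1_H_iff[OF assms(1)] by metis
  also have "U_filtration p k l (k + 1) \<subseteq> {0}"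
    using assms(3) by (auto simp: U_filtration_def U_group_def)
  finally show ?thesis by auto
qed

lemma shift_in_hom_D1_H:
  assumes "prime p" "f \<in> hom_D1_H p k" "z \<in> carrier (Fp_omega p)"
  shows "shift (Fp_omega p) z f \<in> hom_D1_H p k"
proof -
  interpret G: comm_group "Fp_omega p" by (rule comm_group_Fp_omega)
  let ?G = "Fp_omega p"
  have f: "f \<in> carrier ?G \<rightarrow>\<^sub>E points (H_nilspace p k)"
    using assms(2) by (simp add: hom_D1_H_iff[OF assms(1)])
  have "shift ?G z f \<in> carrier ?G \<rightarrow>\<^sub>E points (H_nilspace p k)"
    using f assms(3) by (auto simp: shift_def PiE_iff simp del: Pi_iff)
  moreover have "iter_gdiff ?G hs (\<lambda>x. shift ?G z f x (l, m)) x mod int (U_order p k l) \<in> U_filtration p k l (length hs)"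
    if "l \<in> {1..k}" "set hs \<subseteq> carrier ?G" "x \<in> carrier ?G" for l m hs x
  proof -
    have "iter_gdiff ?G hs (\<lambda>x. shift ?G z f x (l, m)) x = iter_gdiff ?G hs (\<lambda>x. f (x \<otimes>\<^bsub>?G\<^esub> z) (l, m)) x"
      using that by (intro G.iter_gdiff_cong) (auto simp: shift_def)
    also have "\<dots> = iter_gdiff ?G hs (\<lambda>x. f x (l, m)) (x \<otimes>\<^bsub>?G\<^esub> z)"
      using that assms(3) by (intro G.iter_gdiff_translate)
    finally show ?thesis
      using that assms(2,3) by (simp add: hom_D1_H_iff[OF assms(1)])
  qed
  ultimately show ?thesis by (simp add: hom_D1_H_iff[OF assms(1)])
qed

text \<open>
  The level \<open>l\<close> congruent to \<open>k\<close> modulo \<open>p - 1\<close> with \<open>1 \<le> l \<le> p - 1\<close>. It is a level at which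
  the cyclic group is largest and the filtration is no stricter than what every polynomial of degree
  at most \<open>k\<close> satisfies.
\<close>

definition top_level :: "nat \<Rightarrow> nat \<Rightarrow> nat" where
  "top_level p k = k - (k - 1) div (p - 1) * (p - 1)"

lemma top_level:
  assumes "k \<ge> 1"
  shows "top_level p k \<in> {1..k}" "k - top_level p k = (k - 1) div (p - 1) * (p - 1)"
proof -
  define r where "r = (k - 1) div (p - 1) * (p - 1)"
  have "r \<le> k - 1" unfolding r_def by (rule div_times_less_eq_dividend)
  then show "top_level p k \<in> {1..k}" "k - top_level p k = (k - 1) div (p - 1) * (p - 1)"
    using assms unfolding top_level_def r_def[symmetric] by auto
qed

lemma U_order_top_level:
  assumes "prime p" "k \<ge> 1"
  shows "U_order p k (top_level p k) = p ^ ((k - 1) div (p - 1) + 1)"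
proof -
  have "0 < p - 1" using prime_ge_2_nat[OF assms(1)] by simp
  then show ?thesis
    unfolding U_order_def top_level(2)[OF assms(2)] by (simp only: div_mult_self_is_m)
qed

text \<open>
  An \<open>i\<close>-fold difference of a polynomial of degree at most \<open>k\<close> is annihilated by \<open>p\<^sup>j\<close> as soon as
  \<open>i + j(p-1) > k\<close>. For \<open>i > l\<close>, with \<open>k - l = q(p-1)\<close> and \<open>s = \<lfloor>(i-l-1)/(p-1)\<rfloor>\<close> this holds for \<open>j = q - s\<close>, and
  in the cyclic group of order \<open>p\<^sup>q\<^sup>+\<^sup>1\<close> the elements annihilated by \<open>p\<^sup>q\<^sup>-\<^sup>s\<close> are the multiples of
  \<open>p\<^sup>s\<^sup>+\<^sup>1\<close>, that is, the \<open>i\<close>-th term of the filtration.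
\<close>

lemma polynomial_respects_top_filtration:
  fixes a :: "(nat \<Rightarrow> int) \<Rightarrow> int"
  assumes "prime p" "k \<ge> 1"
  defines "N \<equiv> U_order p k (top_level p k)"
  assumes deg: "\<And>hs x. set hs \<subseteq> carrier (Fp_omega p) \<Longrightarrow> length hs = k + 1 \<Longrightarrow> x \<in> carrier (Fp_omega p)
       \<Longrightarrow> int N dvd iter_gdiff (Fp_omega p) hs a x"
    and hs: "set hs \<subseteq> carrier (Fp_omega p)" and x: "x \<in> carrier (Fp_omega p)"
  shows "iter_gdiff (Fp_omega p) hs a x mod int N \<in> U_filtration p k (top_level p k) (length hs)"
proof -
  interpret G: comm_group "Fp_omega p" by (rule comm_group_Fp_omega)
  define l where "l = top_level p k"
  define q where "q = (k - 1) div (p - 1)"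
  define d where "d = iter_gdiff (Fp_omega p) hs a x"
  define s where "s = (length hs - l - 1) div (p - 1)"
  have p: "p \<ge> 2" using assms(1) by (rule prime_ge_2_nat)
  have l: "1 \<le> l" "l \<le> k" "k - l = q * (p - 1)"
    using top_level[OF assms(2), of p] by (auto simp: l_def q_def)
  have N: "N = p ^ (q + 1)" unfolding N_def q_def by (rule U_order_top_level[OF assms(1,2)])
  have Npos: "N > 0" using p by (simp add: N)
  show ?thesis
  proof (cases "length hs \<le> l")
    case True
    then show ?thesis
      using Npos by (simp add: U_filtration_def carrier_U_group assms(1) l_def flip: N_def)
  next
    case False
    (* Truncation at j = 0 covers s > q; then there are more than k differences. *)
    define j where "j = q - s"
    have "s * (p - 1) \<le> length hs - l - 1"
      unfolding s_def by (rule div_times_less_eq_dividend)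
    then have "k + 1 \<le> length hs + j * (p - 1)"
      using l False by (auto simp: j_def diff_mult_distrib)
    then have "of_nat p ^ j * iter_gdiff (Fp_omega p) hs (\<lambda>x. real_of_int (a x) / real N) x \<in> \<int>"
    proof (intro G.prime_power_mult_lowers_degree[OF assms(1), where n = "k + 1"])
      fix hs x
      assume hs': "set hs \<subseteq> carrier (Fp_omega p)" "length hs = k + 1" "x \<in> carrier (Fp_omega p)"
      then obtain c where "iter_gdiff (Fp_omega p) hs a x = int N * c"
        using deg by (meson dvdE)
      then show "iter_gdiff (Fp_omega p) hs (\<lambda>x. real_of_int (a x) / real N) x \<in> \<int>"
        using Npos by (simp add: iter_gdiff_of_int_divide)
    qed (use hs x False p in \<open>auto simp: Fp_omega_pow_prime\<close>)
    then obtain c where "real p ^ j * (real_of_int d / real N) = of_int c"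
      by (auto simp: iter_gdiff_of_int_divide d_def elim: Ints_cases)
    then have "real_of_int (int p ^ j * d) = real_of_int (int N * c)"
      using Npos by (simp add: field_simps)
    then have eq: "int p ^ j * d = int N * c" by (simp only: of_int_eq_iff)
    have "\<exists>y\<in>{0..<int N}. d mod int N = (int (p ^ (s + 1)) * y) mod int N"
    proof (cases "s \<le> q")
      case True
      then have "int N = int p ^ j * int p ^ (s + 1)"
        by (simp add: N j_def flip: power_add)
      with eq p have "d = int p ^ (s + 1) * c" by simp
      then show ?thesis
        using Npos by (intro bexI[of _ "c mod int N"]) (auto simp: mod_mult_right_eq)
    next
      case False
      with eq have "d = int N * c" by (simp add: j_def)
      then show ?thesis using Npos by (intro bexI[of _ 0]) auto
    qed
    then obtain y where y: "y \<in> {0..<int N}" "d mod int N = (int (p ^ (s + 1)) * y) mod int N" by blast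
    have "(\<lambda>x. x [^]\<^bsub>U_group p k l\<^esub> (p ^ (s + 1))) y = (int (p ^ (s + 1)) * y) mod int N"
      unfolding U_group_def by (simp add: N_def U_order_def l_def)
    then have "d mod int N \<in> (\<lambda>x. x [^]\<^bsub>U_group p k l\<^esub> (p ^ (s + 1))) ` carrier (U_group p k l)"
      using y by (auto simp: carrier_U_group[OF assms(1)] N_def l_def intro!: image_eqI[of _ _ y])
    then show ?thesis
      using False by (simp add: U_filtration_def l_def s_def d_def)
  qed
qed

section \<open>Phase polynomials and the topology of the space of morphisms\<close>

definition unit_root :: "nat \<Rightarrow> int \<Rightarrow> complex" where
  "unit_root N a = cis (2 * pi * (real_of_int a / real N))"

text \<open>
  Residues code roots of unity, which translates between the multiplicative phase polynomials and
  the additive groups \<open>\<U>\<^sub>k\<^sub>,\<^sub>l\<close>.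
\<close>

lemma bij_betw_unit_root:
  assumes "N > 0"
  shows "bij_betw (unit_root N) {0..<int N} {z. z ^ N = 1}"
proof -
  have "bij_betw ((\<lambda>j. cis (2 * pi * real j / real N)) \<circ> nat) {0..<int N} {z. z ^ N = 1}"
    by (rule bij_betw_trans[OF _ Complex.bij_betw_roots_unity[OF assms]])
      (rule bij_betwI[where g = int], auto)
  then show ?thesis
    by (rule bij_betw_cong[THEN iffD1, rotated]) (auto simp: unit_root_def)
qed

lemma unit_root_inject:
  assumes "N > 0" "a \<in> {0..<int N}" "b \<in> {0..<int N}"
  shows "unit_root N a = unit_root N b \<longleftrightarrow> a = b"
  using bij_betw_unit_root[OF assms(1)] assms(2,3) by (auto simp: bij_betw_def inj_on_def)

lemma cis_2pi_eq_1_iff: "cis (2 * pi * t) = 1 \<longleftrightarrow> t \<in> \<int>"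
proof
  assume "cis (2 * pi * t) = 1"
  then have "cos (2 * pi * t) = 1" by (simp add: complex_eq_iff)
  then obtain n :: int where "2 * pi * t = n * 2 * pi" by (auto simp: cos_one_2pi_int)
  then have "t = of_int n" by simp
  then show "t \<in> \<int>" by simp
qed simp

text \<open>
  With \<open>\<phi> = exp(2\<pi>i\<theta>)\<close> along an orbit, the multiplicative derivative of \<open>\<phi>\<close> is the exponential of
  the difference of \<open>\<theta>\<close>; commutativity reconciles acting on a point of the orbit with right
  multiplication in the group.
\<close>

lemma iter_mult_deriv_along_orbit:
  assumes "group_action G E \<alpha>" "comm_group G" "y \<in> E"
    and "\<And>w. w \<in> carrier G \<Longrightarrow> \<phi> (\<alpha> w y) = cis (2 * pi * \<theta> w)"
    and "set zs \<subseteq> carrier G" "w \<in> carrier G"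
  shows "foldr (mult_deriv \<alpha>) zs \<phi> (\<alpha> w y) = cis (2 * pi * iter_gdiff G zs \<theta> w)"
  using assms(5,6)
proof (induction zs arbitrary: w)
  case Nil
  then show ?case using assms(4) by simp
next
  case (Cons z zs)
  interpret group_action G E \<alpha> by fact
  interpret comm_group G by fact
  have "\<alpha> z (\<alpha> w y) = \<alpha> (w \<otimes>\<^bsub>G\<^esub> z) y"
    using Cons.prems assms(3) composition_rule[of y z w] by (simp add: m_comm)
  then have "foldr (mult_deriv \<alpha>) (z # zs) \<phi> (\<alpha> w y)
      = cis (2 * pi * iter_gdiff G zs \<theta> (w \<otimes>\<^bsub>G\<^esub> z)) * cnj (cis (2 * pi * iter_gdiff G zs \<theta> w))"
    using Cons.IH[of w] Cons.IH[of "w \<otimes>\<^bsub>G\<^esub> z"] Cons.prems by (simp add: mult_deriv_def[of _ z])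
  also have "\<dots> = cis (2 * pi * iter_gdiff G (z # zs) \<theta> w)"
    by (simp add: cis_cnj cis_mult gdiff_def algebra_simps)
  finally show ?case .
qed

lemma group_action_one:
  assumes "group_action G E \<alpha>" "y \<in> E"
  shows "\<alpha> \<one>\<^bsub>G\<^esub> y = y"
  using group_action.id_eq_one[OF assms(1)] assms(2) by (metis restrict_apply')

text \<open>
  Deriving \<open>k + 1\<close> times in the direction of the neutral element raises the absolute value to the
  power \<open>2\<^sup>k\<^sup>+\<^sup>1\<close>, and the result is 1.
\<close>

lemma phase_polynomial_norm:
  assumes "group_action G (topspace X) \<alpha>" "\<phi> \<in> phase_polynomials G X \<alpha> k" "y \<in> topspace X"
  shows "norm (\<phi> y) = 1"
proof -
  interpret group_action G "topspace X" \<alpha> by fact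
  have "\<one>\<^bsub>G\<^esub> \<in> carrier G"
    using group_hom by (simp add: group_hom_def group.is_monoid monoid.one_closed)
  have "norm (foldr (mult_deriv \<alpha>) (replicate m \<one>\<^bsub>G\<^esub>) \<phi> y) = norm (\<phi> y) ^ (2 ^ m)" for m
  proof (induction m)
    case (Suc m)
    then show ?case
      by (simp add: mult_deriv_def group_action_one[OF assms(1,3)] norm_mult power_add[symmetric] mult_2)
  qed simp
  moreover have "foldr (mult_deriv \<alpha>) (replicate (k + 1) \<one>\<^bsub>G\<^esub>) \<phi> y = 1"
  proof -
    have "length (replicate (k + 1) \<one>\<^bsub>G\<^esub>) = k + 1 \<and> set (replicate (k + 1) \<one>\<^bsub>G\<^esub>) \<subseteq> carrier G"
      using \<open>\<one>\<^bsub>G\<^esub> \<in> carrier G\<close> by auto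
    then show ?thesis using assms(2,3) unfolding phase_polynomials_def by blast
  qed
  ultimately have "norm (\<phi> y) ^ (2 ^ (k + 1)) = 1" by (metis norm_one)
  then show ?thesis
    using power_eq_imp_eq_base[of "norm (\<phi> y)" "2 ^ (k + 1)" 1] by simp
qed

lemma one_in_phase_polynomials: "(\<lambda>_. 1) \<in> phase_polynomials G X \<alpha> k"
proof -
  have "foldr (mult_deriv \<alpha>) zs (\<lambda>_. 1) = (\<lambda>_. 1)" for zs
    by (induction zs) (simp_all add: mult_deriv_def)
  then show ?thesis by (simp add: phase_polynomials_def)
qed

text \<open>
  If all phase polynomials agree at \<open>x\<close> and \<open>y\<close>, so does the algebra they generate, which then
  cannot approximate a continuous function with the values 0 and 1 at these points.
\<close>

lemma phase_polynomials_separate: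
  assumes "compact_space X" "Hausdorff_space X" "topological_Abramov G X \<alpha> k"
    and "x \<in> topspace X" "y \<in> topspace X" "x \<noteq> y"
  shows "\<exists>\<phi>\<in>phase_polynomials G X \<alpha> k. \<phi> x \<noteq> \<phi> y"
proof (rule ccontr)
  assume neg: "\<not> ?thesis"
  have eq: "\<phi> x = \<phi> y" if "\<phi> \<in> generated_algebra (phase_polynomials G X \<alpha> k)" for \<phi>
    using that by induction (use neg in auto)
  have "normal_space X"
    using assms(1,2) by (simp add: compact_Hausdorff_or_regular_imp_normal_space)
  moreover have "closedin X {x}" "closedin X {y}" "disjnt {x} {y}"
    using assms by (auto simp: closedin_Hausdorff_singleton)
  ultimately obtain f where f: "continuous_map X euclideanreal f" "f ` {x} \<subseteq> {0}" "f ` {y} \<subseteq> {1}"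
    by (rule Urysohn_lemma_alt)
  have "continuous_map X euclidean (\<lambda>w. complex_of_real (f w))"
    using continuous_map_compose[OF f(1), of euclidean complex_of_real]
    by (simp add: o_def continuous_map_iff_continuous2 continuous_on_of_real)
  then obtain \<phi> where \<phi>: "\<phi> \<in> generated_algebra (phase_polynomials G X \<alpha> k)"
    "\<forall>w\<in>topspace X. norm (complex_of_real (f w) - \<phi> w) < 1/2"
    using assms(3) unfolding topological_Abramov_def by (metis half_gt_zero_iff zero_less_one)
  have "norm (0 - \<phi> x) < 1/2" "norm (1 - \<phi> x) < 1/2"
    using \<phi>(2) assms(4,5) f(2,3) eq[OF \<phi>(1)] by force+
  then show False
    using norm_triangle_ineq4[of "1 - \<phi> x" "0 - \<phi> x"] by simp
qed

text \<open>
  For each pair of sets from a countable base, choose one function with disjoint images on the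
  two sets, whenever there is one.
\<close>

lemma countable_separating_subfamily:
  fixes \<Phi> :: "('a \<Rightarrow> 'b::t2_space) set"
  assumes "second_countable X" and cont: "\<And>\<phi>. \<phi> \<in> \<Phi> \<Longrightarrow> continuous_map X euclidean \<phi>"
    and sep: "\<And>x y. x \<in> topspace X \<Longrightarrow> y \<in> topspace X \<Longrightarrow> x \<noteq> y \<Longrightarrow> \<exists>\<phi>\<in>\<Phi>. \<phi> x \<noteq> \<phi> y"
  obtains \<Psi> where "countable \<Psi>" "\<Psi> \<subseteq> \<Phi>"
    "\<And>x y. x \<in> topspace X \<Longrightarrow> y \<in> topspace X \<Longrightarrow> x \<noteq> y \<Longrightarrow> \<exists>\<phi>\<in>\<Psi>. \<phi> x \<noteq> \<phi> y"
proof -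
  obtain \<B> where \<B>: "countable \<B>"
    "\<And>U x. openin X U \<Longrightarrow> x \<in> U \<Longrightarrow> \<exists>V\<in>\<B>. x \<in> V \<and> V \<subseteq> U"
    using assms(1) unfolding second_countable_def by meson
  define separates where "separates U V \<phi> \<longleftrightarrow> \<phi> \<in> \<Phi> \<and> \<phi> ` U \<inter> \<phi> ` V = {}" for U V \<phi>
  define \<Psi> where "\<Psi> = (\<lambda>(U, V). SOME \<phi>. separates U V \<phi>) ` {(U, V) \<in> \<B> \<times> \<B>. \<exists>\<phi>. separates U V \<phi>}"
  show ?thesis
  proof
    have "countable {(U, V) \<in> \<B> \<times> \<B>. \<exists>\<phi>. separates U V \<phi>}"
      by (rule countable_subset[OF _ countable_SIGMA[OF \<B>(1) \<B>(1)]]) auto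
    then show "countable \<Psi>" unfolding \<Psi>_def by (rule countable_image)
    have some: "separates U V (SOME \<phi>. separates U V \<phi>)" if "\<exists>\<phi>. separates U V \<phi>" for U V
      using that by (rule someI_ex)
    then show "\<Psi> \<subseteq> \<Phi>" by (auto simp: \<Psi>_def separates_def)
    fix x y assume xy: "x \<in> topspace X" "y \<in> topspace X" "x \<noteq> y"
    then obtain \<phi> where \<phi>: "\<phi> \<in> \<Phi>" "\<phi> x \<noteq> \<phi> y" using sep by blast
    then obtain S T where ST: "open S" "open T" "\<phi> x \<in> S" "\<phi> y \<in> T" "S \<inter> T = {}"
      by (meson hausdorff)
    have "openin X {z \<in> topspace X. \<phi> z \<in> S}" "openin X {z \<in> topspace X. \<phi> z \<in> T}"
      using ST cont[OF \<phi>(1)] by (auto intro: openin_continuous_map_preimage)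
    moreover have "x \<in> {z \<in> topspace X. \<phi> z \<in> S}" "y \<in> {z \<in> topspace X. \<phi> z \<in> T}"
      using xy ST by auto
    ultimately obtain U V where U: "U \<in> \<B>" "x \<in> U" "U \<subseteq> {z \<in> topspace X. \<phi> z \<in> S}"
      and V: "V \<in> \<B>" "y \<in> V" "V \<subseteq> {z \<in> topspace X. \<phi> z \<in> T}"
      using \<B>(2) by meson
    have "\<phi> ` U \<subseteq> S" "\<phi> ` V \<subseteq> T"
      using U(3) V(3) by auto
    then have "\<phi> ` U \<inter> \<phi> ` V = {}"
      using ST(5) by (metis (no_types) Int_mono subset_empty)
    with \<phi>(1) have "separates U V \<phi>"
      by (simp add: separates_def)
    then have "\<exists>\<phi>. separates U V \<phi>" by (rule exI[of _ \<phi>])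
    define \<psi> where "\<psi> = (SOME \<phi>. separates U V \<phi>)"
    have "\<psi> \<in> \<Psi>"
      unfolding \<Psi>_def \<psi>_def using U(1) V(1) \<open>\<exists>\<phi>. separates U V \<phi>\<close> by (auto intro!: image_eqI[of _ _ "(U, V)"])
    moreover have "\<psi> x \<noteq> \<psi> y"
      using some[OF \<open>\<exists>\<phi>. separates U V \<phi>\<close>] U(2) V(2) unfolding separates_def \<psi>_def by blast
    ultimately show "\<exists>\<phi>\<in>\<Psi>. \<phi> x \<noteq> \<phi> y" by blast
  qed
qed

lemma continuous_map_discreteI:
  assumes "f \<in> topspace X \<rightarrow> U" "\<And>u. u \<in> U \<Longrightarrow> openin X {x \<in> topspace X. f x = u}"
  shows "continuous_map X (discrete_topology U) f"
  unfolding continuous_map_def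
proof (intro conjI allI impI)
  fix V assume "openin (discrete_topology U) V"
  then have "V \<subseteq> U" by simp
  then have "openin X (\<Union>u\<in>V. {x \<in> topspace X. f x = u})"
    using assms(2) by (intro openin_Union) auto
  also have "(\<Union>u\<in>V. {x \<in> topspace X. f x = u}) = {x \<in> topspace X. f x \<in> V}" by auto
  finally show "openin X {x \<in> topspace X. f x \<in> V}" .
qed (use assms(1) in simp)

lemma continuous_action_map:
  assumes "continuous_action G X \<alpha>" "z \<in> carrier G"
  shows "continuous_map X X (\<alpha> z)"
proof -
  have "continuous_map X X ((\<lambda>(z, x). \<alpha> z x) \<circ> (\<lambda>x. (z, x)))"
    using assms unfolding continuous_action_def
    by (intro continuous_map_compose[of X "prod_topology (discrete_topology (carrier G)) X"])
      (auto intro!: continuous_map_pairedI)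
  then show ?thesis by (simp add: o_def)
qed

text \<open>
  Continuity gives one inclusion; the other holds because the compact image is closed.
\<close>

lemma image_dense_orbit:
  assumes "compact_space X" "Hausdorff_space Y" "continuous_map X Y h"
    and "S \<subseteq> topspace X" "X closure_of S = topspace X"
  shows "h ` topspace X = Y closure_of (h ` S)"
proof
  show "h ` topspace X \<subseteq> Y closure_of (h ` S)"
    using continuous_map_image_closure_subset[OF assms(3), of S] assms(5) by simp
  have "closedin Y (h ` topspace X)"
    using assms(1-3) by (meson compact_space_def compactin_imp_closedin image_compactin)
  then show "Y closure_of (h ` S) \<subseteq> h ` topspace X"
    using assms(4) by (intro closure_of_minimal) auto
qed

lemma continuous_map_H_coordinate:
  assumes "l \<in> {1..k}"
  shows "continuous_map (H_topology p k) (discrete_topology (points (U_nilspace p k l))) (\<lambda>u. u (l, m))"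
  using continuous_map_product_projection[of "(l, m)" "{1..k} \<times> UNIV"
      "\<lambda>(l, m). discrete_topology (points (U_nilspace p k l))"] assms
  unfolding H_topology_def by simp

lemma continuous_map_hom_coordinate:
  assumes "x \<in> carrier (Fp_omega p)" "l \<in> {1..k}"
  shows "continuous_map (hom_topology p k) (discrete_topology (points (U_nilspace p k l))) (\<lambda>f. f x (l, m))"
proof -
  have "continuous_map (hom_topology p k) (H_topology p k) (\<lambda>f. f x)"
    unfolding hom_topology_def using assms(1)
    by (intro continuous_map_from_subtopology continuous_map_product_projection)
  from continuous_map_compose[OF this continuous_map_H_coordinate[OF assms(2)]]
  show ?thesis by (simp add: o_def)
qed

lemma topspace_H_topology: "topspace (H_topology p k) = points (H_nilspace p k)"
  by (auto simp: H_topology_def H_nilspace_def prod_nilspace_def PiE_iff split: prod.splits)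

lemma topspace_hom_topology: "topspace (hom_topology p k) = hom_D1_H p k"
  unfolding hom_topology_def
  by (auto simp: topspace_H_topology hom_D1_H_def nilspace_hom_def D1_def group_nilspace_def)

lemma Hausdorff_hom_topology: "Hausdorff_space (hom_topology p k)"
  unfolding hom_topology_def H_topology_def
  by (intro Hausdorff_space_subtopology) (auto simp: Hausdorff_space_product_topology)

lemma continuous_map_into_hom_topology:
  assumes "h \<in> topspace X \<rightarrow> hom_D1_H p k"
    and "\<And>x l m. x \<in> carrier (Fp_omega p) \<Longrightarrow> l \<in> {1..k} \<Longrightarrow>
       continuous_map X (discrete_topology (points (U_nilspace p k l))) (\<lambda>y. h y x (l, m))"
  shows "continuous_map X (hom_topology p k) h"
  unfolding hom_topology_def
proof (rule continuous_map_into_subtopology)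
  have h: "h y \<in> carrier (Fp_omega p) \<rightarrow>\<^sub>E points (H_nilspace p k)" if "y \<in> topspace X" for y
    using assms(1) that by (auto simp: hom_D1_H_def nilspace_hom_def D1_def group_nilspace_def simp del: PiE_iff)
  have ext: "h y x \<in> extensional ({1..k} \<times> UNIV)" if "y \<in> topspace X" "x \<in> carrier (Fp_omega p)" for x y
    using PiE_mem[OF h[OF that(1)] that(2)] by (simp add: H_nilspace_def prod_nilspace_def PiE_iff)
  have "continuous_map X (H_topology p k) (\<lambda>y. h y x)" if "x \<in> carrier (Fp_omega p)" for x
    unfolding H_topology_def continuous_map_componentwise using ext assms(2) that by auto
  then show "continuous_map X (product_topology (\<lambda>_. H_topology p k) (carrier (Fp_omega p))) h"
    unfolding continuous_map_componentwise using h by (auto simp: PiE_iff)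
qed (use assms(1) in auto)

lemma continuous_map_from_discrete_compose:
  assumes "continuous_map X (discrete_topology U) f" "g \<in> U \<rightarrow> topspace Y"
  shows "continuous_map X Y (\<lambda>x. g (f x))"
  using continuous_map_compose[OF assms(1), of Y g] assms(2) by (simp add: o_def)

section \<open>Transitive Abramov systems as orbit closures\<close>

lemma iter_gdiff_add_const:
  assumes "hs \<noteq> []"
  shows "iter_gdiff G hs (\<lambda>x. c + P x) = iter_gdiff G hs P"
proof -
  obtain hs' h where "hs = hs' @ [h]" using assms by (metis rev_exhaust)
  then show ?thesis by (simp add: gdiff_def)
qed

text \<open>
  Write \<open>\<phi> = exp(2\<pi>i\<theta>)\<close> along the dense orbit and \<open>q = \<lfloor>(k-1)/(p-1)\<rfloor>\<close>. Then \<open>\<theta>(w) - \<theta>(1)\<close> is a first difference, so \<open>q + 1\<close> multiplications by \<open>p\<close> make it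
  an integer because \<open>1 + (q+1)(p-1) > k\<close>. The resulting equation is closed and extends to the whole
  space.
\<close>

lemma phase_polynomial_root_of_unity:
  assumes "prime p" "k \<ge> 1" "group_action (Fp_omega p) (topspace X) \<alpha>"
    and \<phi>: "\<phi> \<in> phase_polynomials (Fp_omega p) X \<alpha> k"
    and x0: "x0 \<in> topspace X" "X closure_of orbit (Fp_omega p) \<alpha> x0 = topspace X"
    and y: "y \<in> topspace X"
  shows "(\<phi> y * cnj (\<phi> x0)) ^ U_order p k (top_level p k) = 1"
proof -
  let ?G = "Fp_omega p"
  interpret G: comm_group ?G by (rule comm_group_Fp_omega)
  interpret group_action ?G "topspace X" \<alpha> by fact
  define N where "N = U_order p k (top_level p k)"
  define \<theta> where "\<theta> w = Arg (\<phi> (\<alpha> w x0)) / (2 * pi)" for w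
  have \<theta>: "\<phi> (\<alpha> w x0) = cis (2 * pi * \<theta> w)" if "w \<in> carrier ?G" for w
  proof -
    have "norm (\<phi> (\<alpha> w x0)) = 1"
      using phase_polynomial_norm[OF assms(3) \<phi>] element_image[OF that x0(1)] by blast
    then show ?thesis
      using rcis_cmod_Arg[of "\<phi> (\<alpha> w x0)"] by (simp add: \<theta>_def rcis_def)
  qed
  have deg: "iter_gdiff ?G hs \<theta> w \<in> \<int>"
    if "set hs \<subseteq> carrier ?G" "length hs = k + 1" "w \<in> carrier ?G" for hs w
  proof -
    have "foldr (mult_deriv \<alpha>) hs \<phi> (\<alpha> w x0) = 1"
      using \<phi> that element_image[OF that(3) x0(1)] unfolding phase_polynomials_def by blast
    then show ?thesis
      using iter_mult_deriv_along_orbit[where \<phi> = \<phi> and \<theta> = \<theta>, OF assms(3) comm_group_Fp_omega x0(1) \<theta> that(1,3)]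
      by (simp add: cis_2pi_eq_1_iff)
  qed
  have on_orbit: "(\<phi> (\<alpha> w x0) * cnj (\<phi> x0)) ^ N = 1" if w: "w \<in> carrier ?G" for w
  proof -
    have "p - 1 > 0" using prime_ge_2_nat[OF assms(1)] by simp
    then have "k - 1 < ((k - 1) div (p - 1) + 1) * (p - 1)"
      using dividend_less_div_times by (metis add.commute add_mult_distrib mult_1)
    then have "k + 1 \<le> length [w] + ((k - 1) div (p - 1) + 1) * (p - 1)"
      by simp
    then have "of_nat p ^ ((k - 1) div (p - 1) + 1) * iter_gdiff ?G [w] \<theta> \<one>\<^bsub>?G\<^esub> \<in> \<int>"
      using w prime_gt_0_nat[OF assms(1)]
      by (intro G.prime_power_mult_lowers_degree[OF assms(1) Fp_omega_pow_prime deg]) auto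
    then have "real N * (\<theta> w - \<theta> \<one>\<^bsub>?G\<^esub>) \<in> \<int>"
      using w by (simp add: N_def U_order_top_level[OF assms(1,2)] gdiff_def del: one_sum_group)
    moreover have "\<phi> (\<alpha> w x0) * cnj (\<phi> x0) = cis (2 * pi * (\<theta> w - \<theta> \<one>\<^bsub>?G\<^esub>))"
      using \<theta>[OF w] \<theta>[OF G.one_closed] group_action_one[OF assms(3) x0(1)]
      by (simp add: cis_cnj cis_mult algebra_simps)
    ultimately show ?thesis
      by (simp add: Complex.DeMoivre cis_2pi_eq_1_iff[symmetric] mult_ac)
  qed
  have "continuous_map X euclidean \<phi>" using \<phi> by (simp add: phase_polynomials_def)
  then have "continuous_map X euclidean (\<lambda>y. (\<phi> y * cnj (\<phi> x0)) ^ N)"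
    using continuous_map_compose[of X euclidean \<phi> euclidean "\<lambda>u. (u * cnj (\<phi> x0)) ^ N"]
    by (simp add: o_def continuous_intros)
  then have "closedin X {y \<in> topspace X. (\<phi> y * cnj (\<phi> x0)) ^ N = 1}"
    by (rule closedin_fiber)
  then have "X closure_of orbit ?G \<alpha> x0 \<subseteq> {y \<in> topspace X. (\<phi> y * cnj (\<phi> x0)) ^ N = 1}"
    using on_orbit element_image x0(1) by (intro closure_of_minimal) (auto simp: orbit_def)
  then show ?thesis using x0(2) y by (auto simp: N_def)
qed

lemma zero_in_U_filtration:
  assumes "prime p"
  shows "0 \<in> U_filtration p k l i"
  using U_order_pos[OF assms, of k l]
  by (auto simp: U_filtration_def carrier_U_group[OF assms] U_group_def intro!: image_eqI[of _ _ 0])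

text \<open>
  The conjugacy sends \<open>y\<close> to the morphism that records at \<open>z\<close> the coded values at \<open>z \<cdot> y\<close> of
  countably many separating phase polynomials, normalised at the point \<open>x0\<close> with dense orbit; the morphism
  \<open>f\<close> is the image of \<open>x0\<close>.
\<close>

lemma transitive_Abramov_imp_orbit_closure:
  assumes "prime p" "k \<ge> 1" "compact_space X" "Hausdorff_space X" "second_countable X"
    and act: "continuous_action (Fp_omega p) X \<alpha>"
    and "transitive_system (Fp_omega p) X \<alpha>" and Abramov: "topological_Abramov (Fp_omega p) X \<alpha> k"
  shows "\<exists>f \<in> hom_D1_H p k.
            conjugate_systems (Fp_omega p) X \<alpha> (orbit_closure p k f) (shift (Fp_omega p))"
proof -
  let ?G = "Fp_omega p" and ?\<Phi> = "phase_polynomials (Fp_omega p) X \<alpha> k"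
  interpret G: comm_group ?G by (rule comm_group_Fp_omega)
  have ga: "group_action ?G (topspace X) \<alpha>" using act by (simp add: continuous_action_def)
  interpret group_action ?G "topspace X" \<alpha> by fact
  obtain x0 where x0: "x0 \<in> topspace X" "X closure_of orbit ?G \<alpha> x0 = topspace X"
    using assms(7) unfolding transitive_system_def by blast
  define l0 where "l0 = top_level p k"
  define N where "N = U_order p k l0"
  have l0: "l0 \<in> {1..k}" unfolding l0_def by (rule top_level(1)[OF assms(2)])
  have Npos: "N > 0" unfolding N_def by (rule U_order_pos[OF assms(1)])
  have cont: "continuous_map X euclidean \<phi>" if "\<phi> \<in> ?\<Phi>" for \<phi>
    using that by (simp add: phase_polynomials_def)
  obtain \<Psi> where \<Psi>: "countable \<Psi>" "\<Psi> \<subseteq> ?\<Phi>"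
    and sep: "\<And>x y. x \<in> topspace X \<Longrightarrow> y \<in> topspace X \<Longrightarrow> x \<noteq> y \<Longrightarrow> \<exists>\<phi>\<in>\<Psi>. \<phi> x \<noteq> \<phi> y"
    using countable_separating_subfamily[OF assms(5) cont phase_polynomials_separate[OF assms(3,4) Abramov]]
    by blast
  (* The constant 1 guarantees a nonempty family to enumerate; for a one-point space the separating one may be empty. *)
  define e where "e = from_nat_into (insert (\<lambda>_. 1) \<Psi>)"
  have range_e: "range e = insert (\<lambda>_. 1) \<Psi>"
    unfolding e_def using \<Psi>(1) by (intro range_from_nat_into) auto
  have e: "e m \<in> ?\<Phi>" for m
  proof -
    have "e m \<in> insert (\<lambda>_. 1) \<Psi>" using range_e by blast
    then show ?thesis using \<Psi>(2) one_in_phase_polynomials by auto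
  qed
  have "\<exists>a\<in>{0..<int N}. unit_root N a = e m y * cnj (e m x0)" if "y \<in> topspace X" for m y
  proof -
    have "e m y * cnj (e m x0) \<in> {z. z ^ N = 1}"
      using phase_polynomial_root_of_unity[OF assms(1,2) ga e x0 that] by (simp add: N_def l0_def)
    then show ?thesis
      using bij_betw_unit_root[OF Npos] unfolding bij_betw_def by (metis imageE)
  qed
  then have "\<exists>a. a \<in> {0..<int N} \<and> unit_root N a = e m y * cnj (e m x0)" if "y \<in> topspace X" for m y
    using that by (simp only: Bex_def)
  note code_ex = someI_ex[OF this]
  define a where "a m y = (SOME a. a \<in> {0..<int N} \<and> unit_root N a = e m y * cnj (e m x0))" for m y
  have a: "a m y \<in> {0..<int N}" "unit_root N (a m y) = e m y * cnj (e m x0)"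
    if "y \<in> topspace X" for m y
    using code_ex[OF that, of m] unfolding a_def by (rule conjunct1, rule conjunct2)
  have e_eq: "e m y = unit_root N (a m y) * e m x0" if "y \<in> topspace X" for m y
  proof -
    have "e m x0 * cnj (e m x0) = 1"
      using phase_polynomial_norm[OF ga e x0(1)] by (simp add: complex_norm_square[symmetric])
    then show ?thesis using a(2)[OF that] by (simp add: mult.assoc mult.commute)
  qed
  have fiber_eq: "a m y = u \<longleftrightarrow> e m y = unit_root N u * e m x0" if "y \<in> topspace X" "u \<in> {0..<int N}" for m y u
  proof -
    have "e m x0 \<noteq> 0"
      using phase_polynomial_norm[OF ga e x0(1), of m] by (metis norm_zero zero_neq_one)
    then have "e m y = unit_root N u * e m x0 \<longleftrightarrow> unit_root N (a m y) = unit_root N u"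
      by (simp only: e_eq[OF that(1)] mult_cancel_right simp_thms)
    also have "\<dots> \<longleftrightarrow> a m y = u"
      by (rule unit_root_inject[OF Npos a(1)[OF that(1)] that(2)])
    finally show ?thesis by blast
  qed
  have cont_a: "continuous_map X (discrete_topology {0..<int N}) (a m)" for m
  proof (rule continuous_map_discreteI)
    fix u assume u: "u \<in> {0..<int N}"
    have "e m ` topspace X \<subseteq> (\<lambda>u. unit_root N u * e m x0) ` {0..<int N}"
      using e_eq a(1) by blast
    then have "finite (e m ` topspace X)" by (rule finite_subset) simp
    then have "openin X {y \<in> topspace X. e m y = unit_root N u * e m x0}"
      by (rule openin_fiber[OF cont[OF e]])
    also have "{y \<in> topspace X. e m y = unit_root N u * e m x0} = {y \<in> topspace X. a m y = u}"
      using fiber_eq[OF _ u] by auto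
    finally show "openin X {y \<in> topspace X. a m y = u}" .
  qed (use a(1) in auto)
  have deg: "int N dvd iter_gdiff ?G hs (\<lambda>w. a m (\<alpha> w y)) x"
    if "y \<in> topspace X" "set hs \<subseteq> carrier ?G" "length hs = k + 1" "x \<in> carrier ?G" for m y hs x
  proof -
    define \<theta>0 where "\<theta>0 = Arg (e m x0) / (2 * pi)"
    have "e m x0 = cis (2 * pi * \<theta>0)"
      using rcis_cmod_Arg[of "e m x0"] phase_polynomial_norm[OF ga e x0(1), of m]
      by (simp add: \<theta>0_def rcis_def)
    then have "e m (\<alpha> w y) = cis (2 * pi * (\<theta>0 + real_of_int (a m (\<alpha> w y)) / real N))"
      if "w \<in> carrier ?G" for w
      using e_eq[OF element_image[OF that \<open>y \<in> topspace X\<close> refl], of m]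
      by (simp add: unit_root_def cis_mult algebra_simps)
    from iter_mult_deriv_along_orbit[where \<phi> = "e m"
        and \<theta> = "\<lambda>w. \<theta>0 + real_of_int (a m (\<alpha> w y)) / real N",
        OF ga comm_group_Fp_omega that(1) this that(2,4)]
    have "foldr (mult_deriv \<alpha>) hs (e m) (\<alpha> x y)
      = cis (2 * pi * iter_gdiff ?G hs (\<lambda>w. \<theta>0 + real_of_int (a m (\<alpha> w y)) / real N) x)" .
    moreover have "foldr (mult_deriv \<alpha>) hs (e m) (\<alpha> x y) = 1"
      using e[of m] that element_image[OF that(4,1) refl] unfolding phase_polynomials_def by blast
    moreover have "hs \<noteq> []" using that(3) by auto
    ultimately have "real_of_int (iter_gdiff ?G hs (\<lambda>w. a m (\<alpha> w y)) x) / real N \<in> \<int>"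
      by (simp add: iter_gdiff_add_const iter_gdiff_of_int_divide flip: cis_2pi_eq_1_iff)
    then obtain c where "real_of_int (iter_gdiff ?G hs (\<lambda>w. a m (\<alpha> w y)) x) / real N = of_int c"
      by (auto elim: Ints_cases)
    then have "real_of_int (iter_gdiff ?G hs (\<lambda>w. a m (\<alpha> w y)) x) = real_of_int (int N * c)"
      using Npos by (simp add: field_simps)
    then show ?thesis by (simp only: of_int_eq_iff dvd_triv_left)
  qed
  define h where "h y = (\<lambda>z\<in>carrier ?G. restrict (\<lambda>(l, m). if l = l0 then a m (\<alpha> z y) else 0) ({1..k} \<times> UNIV))" for y
  have h_apply: "h y z (l, m) = (if l = l0 then a m (\<alpha> z y) else 0)"
    if "z \<in> carrier ?G" "l \<in> {1..k}" for y z l m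
    using that by (simp add: h_def)
  have h_hom: "h y \<in> hom_D1_H p k" if y: "y \<in> topspace X" for y
    unfolding hom_D1_H_iff[OF assms(1)]
  proof (intro conjI ballI allI impI)
    show "h y \<in> carrier ?G \<rightarrow>\<^sub>E points (H_nilspace p k)"
    proof -
      have "a m (\<alpha> z y) \<in> {0..<int N}" if "z \<in> carrier ?G" for m z
        using a(1) element_image[OF that y refl] by blast
      then show ?thesis
        using U_order_pos[OF assms(1)]
        unfolding points_H_nilspace[OF assms(1)] h_def restrict_PiE_iff by (auto simp: N_def)
    qed
  next
    fix l m hs x
    assume l: "l \<in> {1..k}" and hs: "set hs \<subseteq> carrier ?G" and x: "x \<in> carrier ?G"
    have "iter_gdiff ?G hs (\<lambda>x. h y x (l, m)) x
        = iter_gdiff ?G hs (\<lambda>x. if l = l0 then a m (\<alpha> x y) else 0) x"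
      using l hs x by (intro G.iter_gdiff_cong) (auto simp: h_apply)
    moreover have "iter_gdiff ?G hs (\<lambda>x. 0 :: int) x = 0"
      by (induction hs arbitrary: x) (auto simp: gdiff_def)
    ultimately show "iter_gdiff ?G hs (\<lambda>x. h y x (l, m)) x mod int (U_order p k l)
        \<in> U_filtration p k l (length hs)"
      using polynomial_respects_top_filtration[OF assms(1,2), of "\<lambda>z. a m (\<alpha> z y)", OF _ hs x]
        deg[OF y] zero_in_U_filtration[OF assms(1)]
      by (cases "l = l0") (simp_all add: N_def l0_def)
  qed
  have cont_h: "continuous_map X (hom_topology p k) h"
  proof (rule continuous_map_into_hom_topology)
    fix x l m assume x: "x \<in> carrier ?G" and l: "l \<in> {1..k}"
    have "continuous_map X (discrete_topology {0..<int (U_order p k l)}) (\<lambda>y. if l = l0 then a m (\<alpha> x y) else 0)"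
    proof (cases "l = l0")
      case True
      then show ?thesis
        using continuous_map_compose[OF continuous_action_map[OF act x] cont_a[of m]] by (simp add: o_def N_def)
    next
      case False
      then show ?thesis using U_order_pos[OF assms(1)] by simp
    qed
    then show "continuous_map X (discrete_topology (points (U_nilspace p k l))) (\<lambda>y. h y x (l, m))"
      using x l by (simp add: h_apply points_U_nilspace[OF assms(1)])
  qed (use h_hom in auto)
  have inj_h: "inj_on h (topspace X)"
  proof (rule inj_onI, rule ccontr)
    fix x y assume xy: "x \<in> topspace X" "y \<in> topspace X" "h x = h y" "x \<noteq> y"
    then obtain \<phi> where "\<phi> \<in> \<Psi>" "\<phi> x \<noteq> \<phi> y" using sep by blast
    then obtain m where m: "e m x \<noteq> e m y" using range_e by (metis insertCI rangeE)
    have "h x \<one>\<^bsub>?G\<^esub> (l0, m) = h y \<one>\<^bsub>?G\<^esub> (l0, m)" using xy by simp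
    then have "a m x = a m y"
      by (simp only: h_apply[OF G.one_closed l0] simp_thms if_True group_action_one[OF ga xy(1)]
          group_action_one[OF ga xy(2)])
    then show False using m e_eq xy by metis
  qed
  have equi: "h (\<alpha> z y) = shift ?G z (h y)" if "z \<in> carrier ?G" "y \<in> topspace X" for z y
    unfolding h_def shift_def using that by (auto intro!: restrict_ext simp: composition_rule)
  have h_orbit: "h ` orbit ?G \<alpha> x0 = orbit ?G (shift ?G) (h x0)"
    unfolding orbit_def using equi[OF _ x0(1)] by (force simp: image_iff)
  have "orbit ?G \<alpha> x0 \<subseteq> topspace X"
    using element_image x0(1) by (auto simp: orbit_def)
  then have image: "h ` topspace X = hom_topology p k closure_of orbit ?G (shift ?G) (h x0)"
    using image_dense_orbit[OF assms(3) Hausdorff_hom_topology cont_h _ x0(2)] h_orbit by simp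
  have "homeomorphic_map X (orbit_closure p k (h x0)) h"
  proof (rule continuous_imp_homeomorphic_map)
    show "continuous_map X (orbit_closure p k (h x0)) h"
      unfolding orbit_closure_def using cont_h image by (intro continuous_map_into_subtopology) auto
    show "Hausdorff_space (orbit_closure p k (h x0))"
      unfolding orbit_closure_def by (intro Hausdorff_space_subtopology Hausdorff_hom_topology)
    show "h ` topspace X = topspace (orbit_closure p k (h x0))"
      using image closure_of_subset_topspace[of "hom_topology p k"] by (auto simp: orbit_closure_def)
  qed fact+
  then have "conjugate_systems ?G X \<alpha> (orbit_closure p k (h x0)) (shift ?G)"
    unfolding conjugate_systems_def using equi by blast
  then show ?thesis using h_hom[OF x0(1)] by blast
qed

lemma orbit_closure_transitive:
  assumes "prime p" "f \<in> hom_D1_H p k"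
    and h: "homeomorphic_map X (orbit_closure p k f) h"
    and equi: "\<And>z x. z \<in> carrier (Fp_omega p) \<Longrightarrow> x \<in> topspace X \<Longrightarrow> h (\<alpha> z x) = shift (Fp_omega p) z (h x)"
    and ga: "group_action (Fp_omega p) (topspace X) \<alpha>"
  shows "transitive_system (Fp_omega p) X \<alpha>"
proof -
  let ?G = "Fp_omega p" and ?orb = "orbit (Fp_omega p) (shift (Fp_omega p)) f"
  interpret G: comm_group ?G by (rule comm_group_Fp_omega)
  interpret group_action ?G "topspace X" \<alpha> by fact
  have orb_sub: "?orb \<subseteq> topspace (hom_topology p k)"
    using shift_in_hom_D1_H[OF assms(1,2)] by (auto simp: orbit_def topspace_hom_topology)
  then have sub: "?orb \<subseteq> hom_topology p k closure_of ?orb"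
    by (rule closure_of_subset)
  have f_ext: "f \<in> extensional (carrier ?G)"
    using assms(2) by (auto simp: hom_D1_H_iff[OF assms(1)] PiE_iff)
  have "shift ?G \<one>\<^bsub>?G\<^esub> f = f"
    using f_ext G.r_one by (auto simp: shift_def fun_eq_iff extensional_def)
  then have "f \<in> ?orb" unfolding orbit_def using G.one_closed by (metis (mono_tags, lifting) mem_Collect_eq)
  moreover have top: "topspace (orbit_closure p k f) = hom_topology p k closure_of ?orb"
    using closure_of_subset_topspace[of "hom_topology p k" ?orb] by (auto simp: orbit_closure_def)
  ultimately have "f \<in> h ` topspace X"
    using sub homeomorphic_imp_surjective_map[OF h] by auto
  then obtain x0 where x0: "x0 \<in> topspace X" "f = h x0" by blast
  have orb_X: "orbit ?G \<alpha> x0 \<subseteq> topspace X"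
    using element_image x0(1) by (auto simp: orbit_def)
  have "h ` orbit ?G \<alpha> x0 = ?orb"
    unfolding orbit_def x0(2) using equi[OF _ x0(1)] by (force simp: image_iff)
  then have "h ` (X closure_of orbit ?G \<alpha> x0) = orbit_closure p k f closure_of ?orb"
    using homeomorphic_map_closure_of[OF h orb_X] by simp
  also have "\<dots> = topspace (orbit_closure p k f)"
    unfolding top using sub by (simp add: orbit_closure_def closure_of_subtopology Int_absorb1 Int_absorb2)
  also have "\<dots> = h ` topspace X"
    using homeomorphic_imp_surjective_map[OF h] by simp
  finally have "X closure_of orbit ?G \<alpha> x0 = topspace X"
    using homeomorphic_imp_injective_map[OF h] closure_of_subset_topspace[of X]
    by (metis inj_on_image_eq_iff order_refl)
  then show ?thesis unfolding transitive_system_def using x0(1) by blast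
qed

text \<open>
  The phase polynomials are the characters of the coordinates \<open>h y z (l, m)\<close>. Their derivatives along the
  orbit of \<open>y\<close> are those of the morphism \<open>h y\<close> at \<open>z\<close>, because the action becomes the shift.
\<close>

lemma orbit_closure_Abramov:
  assumes "prime p" "f \<in> hom_D1_H p k" "compact_space X"
    and h: "homeomorphic_map X (orbit_closure p k f) h"
    and equi: "\<And>z x. z \<in> carrier (Fp_omega p) \<Longrightarrow> x \<in> topspace X \<Longrightarrow> h (\<alpha> z x) = shift (Fp_omega p) z (h x)"
    and ga: "group_action (Fp_omega p) (topspace X) \<alpha>"
  shows "topological_Abramov (Fp_omega p) X \<alpha> k"
proof -
  let ?G = "Fp_omega p" and ?\<Phi> = "phase_polynomials (Fp_omega p) X \<alpha> k"
  interpret G: comm_group ?G by (rule comm_group_Fp_omega)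
  interpret group_action ?G "topspace X" \<alpha> by fact
  have "continuous_map X (orbit_closure p k f) h"
    using h by (rule homeomorphic_imp_continuous_map)
  then have cont_h: "continuous_map X (hom_topology p k) h"
    unfolding orbit_closure_def by (simp add: continuous_map_in_subtopology)
  have h_hom: "h y \<in> hom_D1_H p k" if "y \<in> topspace X" for y
    using continuous_map_image_subset_topspace[OF cont_h] that by (auto simp: topspace_hom_topology)
  define \<phi> where "\<phi> z l m = (\<lambda>y. unit_root (U_order p k l) (h y z (l, m)))" for z l m
  define P where "P = insert (\<lambda>_. 1) {\<phi> z l m |z l m. z \<in> carrier ?G \<and> l \<in> {1..k}}"
  have coord: "h y z (l, m) \<in> {0..<int (U_order p k l)}"
    if "y \<in> topspace X" "z \<in> carrier ?G" "l \<in> {1..k}" for y z l m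
    using hom_D1_H_coordinate[OF assms(1) h_hom[OF that(1)] that(3,2)] .
  have cont_\<phi>: "continuous_map X euclidean (\<phi> z l m)" if "z \<in> carrier ?G" "l \<in> {1..k}" for z l m
  proof -
    have "continuous_map X (discrete_topology (points (U_nilspace p k l))) (\<lambda>y. h y z (l, m))"
      using continuous_map_compose[OF cont_h continuous_map_hom_coordinate[OF that, of m]]
      by (simp only: o_def)
    then show ?thesis
      unfolding \<phi>_def by (rule continuous_map_from_discrete_compose) simp
  qed
  have phase: "\<phi> z l m \<in> ?\<Phi>" if z: "z \<in> carrier ?G" and l: "l \<in> {1..k}" for z l m
    unfolding phase_polynomials_def
  proof (intro CollectI conjI allI impI ballI)
    show "continuous_map X euclidean (\<phi> z l m)" using cont_\<phi> that by blast
    fix zs y assume zs: "length zs = k + 1 \<and> set zs \<subseteq> carrier ?G" and y: "y \<in> topspace X"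
    define N where "N = U_order p k l"
    have N: "N > 0" unfolding N_def by (rule U_order_pos[OF assms(1)])
    define \<theta> where "\<theta> w = real_of_int (h y (w \<otimes>\<^bsub>?G\<^esub> z) (l, m)) / real N" for w
    have "\<phi> z l m (\<alpha> w y) = cis (2 * pi * \<theta> w)" if "w \<in> carrier ?G" for w
      using that y z by (simp add: \<phi>_def equi shift_def unit_root_def \<theta>_def N_def G.m_comm)
    from iter_mult_deriv_along_orbit[where \<phi> = "\<phi> z l m" and \<theta> = \<theta>,
        OF ga comm_group_Fp_omega y this _ G.one_closed, of zs]
    have "foldr (mult_deriv \<alpha>) zs (\<phi> z l m) y = cis (2 * pi * iter_gdiff ?G zs \<theta> \<one>\<^bsub>?G\<^esub>)"
      using zs group_action_one[OF ga y] by simp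
    moreover have "iter_gdiff ?G zs \<theta> \<one>\<^bsub>?G\<^esub> = real_of_int (iter_gdiff ?G zs (\<lambda>w. h y w (l, m)) z) / real N"
      unfolding \<theta>_def iter_gdiff_of_int_divide
      using G.iter_gdiff_translate[OF z _ G.one_closed, of zs "\<lambda>w. h y w (l, m)"] zs z by simp
    moreover obtain c where "iter_gdiff ?G zs (\<lambda>w. h y w (l, m)) z = int N * c"
      using hom_D1_H_degree[OF assms(1) h_hom[OF y] l, of zs z m] zs z unfolding N_def by (auto elim: dvdE)
    ultimately show "foldr (mult_deriv \<alpha>) zs (\<phi> z l m) y = 1"
      using N by (simp add: cis_2pi_eq_1_iff)
  qed
  have P_phase: "P \<subseteq> ?\<Phi>"
    unfolding P_def using phase one_in_phase_polynomials by auto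
  have "\<exists>\<psi>\<in>generated_algebra P. \<forall>x\<in>topspace X. norm (F x - \<psi> x) < \<epsilon>"
    if "continuous_map X euclidean F" "\<epsilon> > 0" for F :: "'a \<Rightarrow> complex" and \<epsilon>
  proof (rule generated_algebra_dense[OF assms(3) _ _ _ _ that])
    show "(\<lambda>_. 1) \<in> P" by (simp add: P_def)
    show "continuous_map X euclidean \<psi>" if "\<psi> \<in> P" for \<psi>
      using that P_phase by (auto simp: phase_polynomials_def)
    show "finite (\<psi> ` topspace X)" if "\<psi> \<in> P" for \<psi>
    proof -
      have "finite (\<phi> z l m ` topspace X)" if "z \<in> carrier ?G" "l \<in> {1..k}" for z l m
      proof -
        have "\<phi> z l m ` topspace X \<subseteq> unit_root (U_order p k l) ` {0..<int (U_order p k l)}"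
          unfolding \<phi>_def using coord[OF _ that] by (intro image_subsetI imageI)
        then show ?thesis by (rule finite_subset) simp
      qed
      moreover have "finite ((\<lambda>_. 1 :: complex) ` topspace X)"
        by (rule finite_subset[of _ "{1}"]) auto
      ultimately show ?thesis using that unfolding P_def by auto
    qed
    fix x y assume xy: "x \<in> topspace X" "y \<in> topspace X" "x \<noteq> y"
    then have "h x \<noteq> h y"
      using homeomorphic_imp_injective_map[OF h] by (auto dest: inj_onD)
    moreover have "h x \<in> carrier ?G \<rightarrow>\<^sub>E points (H_nilspace p k)" "h y \<in> carrier ?G \<rightarrow>\<^sub>E points (H_nilspace p k)"
      using h_hom xy by (simp_all add: hom_D1_H_iff[OF assms(1)])
    ultimately obtain z where z: "z \<in> carrier ?G" "h x z \<noteq> h y z"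
      by (metis PiE_ext)
    moreover have "h x z \<in> points (H_nilspace p k)" "h y z \<in> points (H_nilspace p k)"
      using z \<open>h x \<in> _\<close> \<open>h y \<in> _\<close> by auto
    ultimately obtain i where i: "i \<in> {1..k} \<times> UNIV" "h x z i \<noteq> h y z i"
      unfolding points_H_nilspace[OF assms(1)] by (metis PiE_ext)
    then obtain l m where lm: "l \<in> {1..k}" "h x z (l, m) \<noteq> h y z (l, m)" by auto
    have "\<phi> z l m x \<noteq> \<phi> z l m y"
      unfolding \<phi>_def
        unit_root_inject[OF U_order_pos[OF assms(1)] coord[OF xy(1) z(1) lm(1)] coord[OF xy(2) z(1) lm(1)]]
      by (rule lm(2))
    then show "\<exists>\<psi>\<in>P. \<psi> x \<noteq> \<psi> y" unfolding P_def using z lm by blast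
  qed
  moreover have "generated_algebra P \<subseteq> generated_algebra ?\<Phi>"
  proof
    fix \<psi> assume "\<psi> \<in> generated_algebra P"
    then show "\<psi> \<in> generated_algebra ?\<Phi>"
      by induction (use P_phase in \<open>auto intro: generated_algebra.intros\<close>)
  qed
  ultimately show ?thesis unfolding topological_Abramov_def by blast
qed

theorem theorem3p2:
  fixes p k :: nat
    and X :: "'a topology"
    and \<alpha> :: "(nat \<Rightarrow> int) \<Rightarrow> 'a \<Rightarrow> 'a"
  assumes "prime p"
    and "k \<ge> 1"
    and "compact_space X"
    and "Hausdorff_space X"
    and "second_countable X"
    and "continuous_action (Fp_omega p) X \<alpha>"
  shows "(transitive_system (Fp_omega p) X \<alpha> \<and> topological_Abramov (Fp_omega p) X \<alpha> k) \<longleftrightarrow>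
         (\<exists>f \<in> hom_D1_H p k.
            conjugate_systems (Fp_omega p) X \<alpha> (orbit_closure p k f) (shift (Fp_omega p)))"
proof
  assume "transitive_system (Fp_omega p) X \<alpha> \<and> topological_Abramov (Fp_omega p) X \<alpha> k"
  then show "\<exists>f \<in> hom_D1_H p k.
      conjugate_systems (Fp_omega p) X \<alpha> (orbit_closure p k f) (shift (Fp_omega p))"
    using transitive_Abramov_imp_orbit_closure[OF assms] by blast
next
  have ga: "group_action (Fp_omega p) (topspace X) \<alpha>"
    using assms(6) by (simp add: continuous_action_def)
  assume "\<exists>f \<in> hom_D1_H p k.
      conjugate_systems (Fp_omega p) X \<alpha> (orbit_closure p k f) (shift (Fp_omega p))"
  then obtain f h where f: "f \<in> hom_D1_H p k" and h: "homeomorphic_map X (orbit_closure p k f) h"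
    and equi: "\<And>z x. z \<in> carrier (Fp_omega p) \<Longrightarrow> x \<in> topspace X \<Longrightarrow> h (\<alpha> z x) = shift (Fp_omega p) z (h x)"
    unfolding conjugate_systems_def by blast
  show "transitive_system (Fp_omega p) X \<alpha> \<and> topological_Abramov (Fp_omega p) X \<alpha> k"
    using orbit_closure_transitive[OF assms(1) f h equi ga]
      orbit_closure_Abramov[OF assms(1) f assms(3) h equi ga] by blast
qed

end
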